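(* There is a functor $R:\mathsf{Ta}_2\to[\Delta^{op},\mathsf{Cat}]$ such that, for every $X\in\mathsf{Ta}_2$: a) $(RX)_n\cong (RX)_1\times_{(RX)_0}\overset{n}{\cdots}\times_{(RX)_0}(RX)_1$ for all $n\ge2$. b) There is a pseudo-natural transformation $r_X:RX\to X$ which is a levelwise equivalence of categories. c) The map $(r_X)_0:(RX)_0\to X_0$ induces equivalences of categories, for all $n\ge2$, $$(RX)_1\times_{(RX)_0}\overset{n}{\cdots}\times_{(RX)_0}(RX)_1\simeq(RX)_1\times_{X_0}\overset{n}{\cdots}\times_{X_0}(RX)_1 .$$
   Context: For $X:\Delta^{op}\to\mathsf{Cat}$ and $k\ge2$, $X_1\times_{X_0}\overset{k}{\cdots}\times_{X_0}X_1$ denotes the iterated pullback along the face functors $\partial_0,\partial_1:X_1\to X_0$, and the Segal map $\eta_k:X_k\to X_1\times_{X_0}\overset{k}{\cdots}\times_{X_0}X_1$ is the functor whose $j$-th component $X_k\to X_1$ is induced by the map $[1]\to[k]$, $0\mapsto j-1$, $1\mapsto j$. The category $\mathsf{Ta}_2$ of Tamsamani weak 2-categories is the full subcategory of $[\Delta^{op},\mathsf{Cat}]$ on those $X$ with $X_0$ discrete and, for all $k\ge2$, $\eta_k$ an equivalence of categories. In c), the right-hand fiber product is formed using the composites $(RX)_1\rightrightarrows(RX)_0\to X_0$ of the face functors with $(r_X)_0$. A pseudo-natural transformation is a levelwise equivalence if each component functor $(RX)_n\to X_n$ is an equivalence of categories. *)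

theory Defs
  imports Main "HOL-Library.FuncSet"
begin

section \<open>Categories, functors, natural transformations\<close>

text \<open>
  All structure maps are required to be \<open>undefined\<close> off their domains, so that equality of
  records is equality of categories, functors and transformations.
\<close>

record ('o, 'a) category =
  Obj :: "'o set"
  Arr :: "'a set"
  Dom :: "'a \<Rightarrow> 'o"
  Cod :: "'a \<Rightarrow> 'o"
  Id  :: "'o \<Rightarrow> 'a"
  Cmp :: "'a \<Rightarrow> 'a \<Rightarrow> 'a"  \<comment> \<open>\<open>Cmp C g f\<close> is \<open>g\<close> after \<open>f\<close>\<close>

definition hom :: "('o, 'a) category \<Rightarrow> 'o \<Rightarrow> 'o \<Rightarrow> 'a set" where
  "hom C x y = {f \<in> Arr C. Dom C f = x \<and> Cod C f = y}"

definition composable :: "('o, 'a) category \<Rightarrow> 'a \<Rightarrow> 'a \<Rightarrow> bool" where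
  "composable C g f \<longleftrightarrow> g \<in> Arr C \<and> f \<in> Arr C \<and> Dom C g = Cod C f"

locale category =
  fixes C :: "('o, 'a) category"
  assumes dom_obj: "f \<in> Arr C \<Longrightarrow> Dom C f \<in> Obj C"
    and cod_obj: "f \<in> Arr C \<Longrightarrow> Cod C f \<in> Obj C"
    and id_hom: "x \<in> Obj C \<Longrightarrow> Id C x \<in> hom C x x"
    and cmp_hom: "composable C g f \<Longrightarrow> Cmp C g f \<in> hom C (Dom C f) (Cod C g)"
    and id_left: "f \<in> Arr C \<Longrightarrow> Cmp C (Id C (Cod C f)) f = f"
    and id_right: "f \<in> Arr C \<Longrightarrow> Cmp C f (Id C (Dom C f)) = f"
    and assoc: "composable C h g \<Longrightarrow> composable C g f \<Longrightarrow>
                  Cmp C (Cmp C h g) f = Cmp C h (Cmp C g f)"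
    and dom_ext: "Dom C \<in> extensional (Arr C)"
    and cod_ext: "Cod C \<in> extensional (Arr C)"
    and id_ext: "Id C \<in> extensional (Obj C)"
    and cmp_ext: "\<not> composable C g f \<Longrightarrow> Cmp C g f = undefined"

text \<open>Builds a category from raw data by cutting the structure maps down to their domains.\<close>

definition mk_category ::
  "'o set \<Rightarrow> 'a set \<Rightarrow> ('a \<Rightarrow> 'o) \<Rightarrow> ('a \<Rightarrow> 'o) \<Rightarrow> ('o \<Rightarrow> 'a) \<Rightarrow> ('a \<Rightarrow> 'a \<Rightarrow> 'a) \<Rightarrow> ('o, 'a) category"
  where
  "mk_category Ob Ar d c i m =
     \<lparr> Obj = Ob, Arr = Ar, Dom = restrict d Ar, Cod = restrict c Ar, Id = restrict i Ob,
       Cmp = (\<lambda>g f. if g \<in> Ar \<and> f \<in> Ar \<and> d g = c f then m g f else undefined) \<rparr>"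

definition op_category :: "('o, 'a) category \<Rightarrow> ('o, 'a) category" where
  "op_category C =
     \<lparr> Obj = Obj C, Arr = Arr C, Dom = Cod C, Cod = Dom C, Id = Id C, Cmp = (\<lambda>g f. Cmp C f g) \<rparr>"

definition full_subcategory :: "('o, 'a) category \<Rightarrow> 'o set \<Rightarrow> ('o, 'a) category" where
  "full_subcategory C S =
     mk_category (Obj C \<inter> S) {f \<in> Arr C. Dom C f \<in> S \<and> Cod C f \<in> S} (Dom C) (Cod C) (Id C) (Cmp C)"

definition discrete :: "('o, 'a) category \<Rightarrow> bool" where
  "discrete C \<longleftrightarrow> Arr C = Id C ` Obj C"

definition iso_arr :: "('o, 'a) category \<Rightarrow> 'a \<Rightarrow> bool" where
  "iso_arr C f \<longleftrightarrow> f \<in> Arr C \<and>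
     (\<exists>g \<in> hom C (Cod C f) (Dom C f). Cmp C g f = Id C (Dom C f) \<and> Cmp C f g = Id C (Cod C f))"

record ('o1, 'a1, 'o2, 'a2) ftor =
  Src :: "('o1, 'a1) category"
  Tgt :: "('o2, 'a2) category"
  FOb :: "'o1 \<Rightarrow> 'o2"
  FAr :: "'a1 \<Rightarrow> 'a2"

locale is_functor = source: category "Src F" + target: category "Tgt F"
  for F :: "('o1, 'a1, 'o2, 'a2) ftor" +
  assumes ob: "x \<in> Obj (Src F) \<Longrightarrow> FOb F x \<in> Obj (Tgt F)"
    and ar: "f \<in> Arr (Src F) \<Longrightarrow>
               FAr F f \<in> hom (Tgt F) (FOb F (Dom (Src F) f)) (FOb F (Cod (Src F) f))"
    and pres_id: "x \<in> Obj (Src F) \<Longrightarrow> FAr F (Id (Src F) x) = Id (Tgt F) (FOb F x)"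
    and pres_cmp: "composable (Src F) g f \<Longrightarrow>
               FAr F (Cmp (Src F) g f) = Cmp (Tgt F) (FAr F g) (FAr F f)"
    and ob_ext: "FOb F \<in> extensional (Obj (Src F))"
    and ar_ext: "FAr F \<in> extensional (Arr (Src F))"

definition mk_functor ::
  "('o1, 'a1) category \<Rightarrow> ('o2, 'a2) category \<Rightarrow> ('o1 \<Rightarrow> 'o2) \<Rightarrow> ('a1 \<Rightarrow> 'a2) \<Rightarrow>
     ('o1, 'a1, 'o2, 'a2) ftor" where
  "mk_functor A B F0 F1 =
     \<lparr> Src = A, Tgt = B, FOb = restrict F0 (Obj A), FAr = restrict F1 (Arr A) \<rparr>"

definition id_functor :: "('o, 'a) category \<Rightarrow> ('o, 'a, 'o, 'a) ftor" where
  "id_functor A = mk_functor A A (\<lambda>x. x) (\<lambda>f. f)"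

definition comp_functor ::
  "('o2, 'a2, 'o3, 'a3) ftor \<Rightarrow> ('o1, 'a1, 'o2, 'a2) ftor \<Rightarrow> ('o1, 'a1, 'o3, 'a3) ftor"
  (infixr \<open>\<circ>\<^sub>F\<close> 55) where
  "G \<circ>\<^sub>F F = mk_functor (Src F) (Tgt G) (FOb G \<circ> FOb F) (FAr G \<circ> FAr F)"

record ('o1, 'a1, 'o2, 'a2) ntrans =
  NSrc :: "('o1, 'a1, 'o2, 'a2) ftor"
  NTgt :: "('o1, 'a1, 'o2, 'a2) ftor"
  NCmp :: "'o1 \<Rightarrow> 'a2"

locale nat_trans = nsrc: is_functor "NSrc t" + ntgt: is_functor "NTgt t"
  for t :: "('o1, 'a1, 'o2, 'a2) ntrans" +
  assumes src_eq: "Src (NSrc t) = Src (NTgt t)"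
    and tgt_eq: "Tgt (NSrc t) = Tgt (NTgt t)"
    and component: "x \<in> Obj (Src (NSrc t)) \<Longrightarrow>
          NCmp t x \<in> hom (Tgt (NSrc t)) (FOb (NSrc t) x) (FOb (NTgt t) x)"
    and naturality: "f \<in> Arr (Src (NSrc t)) \<Longrightarrow>
          Cmp (Tgt (NSrc t)) (NCmp t (Cod (Src (NSrc t)) f)) (FAr (NSrc t) f)
        = Cmp (Tgt (NSrc t)) (FAr (NTgt t) f) (NCmp t (Dom (Src (NSrc t)) f))"
    and component_ext: "NCmp t \<in> extensional (Obj (Src (NSrc t)))"

definition nat_iso :: "('o1, 'a1, 'o2, 'a2) ntrans \<Rightarrow> bool" where
  "nat_iso t \<longleftrightarrow> nat_trans t \<and> (\<forall>x \<in> Obj (Src (NSrc t)). iso_arr (Tgt (NSrc t)) (NCmp t x))"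

definition naturally_isomorphic ::
  "('o1, 'a1, 'o2, 'a2) ftor \<Rightarrow> ('o1, 'a1, 'o2, 'a2) ftor \<Rightarrow> bool" where
  "naturally_isomorphic F G \<longleftrightarrow> (\<exists>t. nat_iso t \<and> NSrc t = F \<and> NTgt t = G)"

definition is_equivalence :: "('o1, 'a1, 'o2, 'a2) ftor \<Rightarrow> bool" where
  "is_equivalence F \<longleftrightarrow> is_functor F \<and>
     (\<exists>G. is_functor G \<and> Src G = Tgt F \<and> Tgt G = Src F \<and>
          naturally_isomorphic (G \<circ>\<^sub>F F) (id_functor (Src F)) \<and>
          naturally_isomorphic (F \<circ>\<^sub>F G) (id_functor (Tgt F)))"

definition is_isomorphism :: "('o1, 'a1, 'o2, 'a2) ftor \<Rightarrow> bool" where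
  "is_isomorphism F \<longleftrightarrow> is_functor F \<and>
     (\<exists>G. is_functor G \<and> Src G = Tgt F \<and> Tgt G = Src F \<and>
          G \<circ>\<^sub>F F = id_functor (Src F) \<and> F \<circ>\<^sub>F G = id_functor (Tgt F))"

definition functor_category ::
  "('o1, 'a1) category \<Rightarrow> ('o2, 'a2) category \<Rightarrow>
     (('o1, 'a1, 'o2, 'a2) ftor, ('o1, 'a1, 'o2, 'a2) ntrans) category" where
  "functor_category A B =
     mk_category
       {F. is_functor F \<and> Src F = A \<and> Tgt F = B}
       {t. nat_trans t \<and> Src (NSrc t) = A \<and> Tgt (NSrc t) = B}
       NSrc NTgt
       (\<lambda>F. \<lparr> NSrc = F, NTgt = F, NCmp = (\<lambda>x \<in> Obj A. Id B (FOb F x)) \<rparr>)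
       (\<lambda>u t. \<lparr> NSrc = NSrc t, NTgt = NTgt u, NCmp = (\<lambda>x \<in> Obj A. Cmp B (NCmp u x) (NCmp t x)) \<rparr>)"


section \<open>Small categories and simplicial objects\<close>

text \<open>
  The type \<open>'u\<close> plays the role of the universe: a small category is one whose objects and
  arrows are elements of \<open>'u\<close>.
\<close>

type_synonym 'u scat = "('u, 'u) category"
type_synonym 'u sfun = "('u, 'u, 'u, 'u) ftor"

definition Cat :: "('u scat, 'u sfun) category" where
  "Cat = mk_category {C. category C} {F. is_functor F} Src Tgt id_functor (\<circ>\<^sub>F)"

text \<open>
  The object \<open>n\<close> of \<open>\<Delta>\<close> is the ordinal \<open>[n] = {0 < \<dots> < n}\<close>; a monotone map
  \<open>f : [m] \<rightarrow> [n]\<close> is the triple \<open>(m, f, n)\<close> with \<open>f\<close> undefined off \<open>[m]\<close>.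
\<close>

type_synonym darr = "nat \<times> (nat \<Rightarrow> nat) \<times> nat"

definition Delta :: "(nat, darr) category" where
  "Delta = mk_category UNIV
     {(m, f, n). f \<in> {..m} \<rightarrow>\<^sub>E {..n} \<and> mono_on {..m} f}
     fst (snd \<circ> snd)
     (\<lambda>n. (n, \<lambda>i \<in> {..n}. i, n))
     (\<lambda>(_, g, p) (m, f, _). (m, compose {..m} g f, p))"

abbreviation Delta_op :: "(nat, darr) category" where
  "Delta_op \<equiv> op_category Delta"

type_synonym 'u simp_cat = "(nat, darr, 'u scat, 'u sfun) ftor"
type_synonym 'u simp_map = "(nat, darr, 'u scat, 'u sfun) ntrans"

definition SimpCat :: "('u simp_cat, 'u simp_map) category" where
  "SimpCat = functor_category Delta_op Cat"

text \<open>The \<open>i\<close>-th coface \<open>[0] \<rightarrow> [1]\<close> omits \<open>i\<close>, so \<open>face X 0\<close> is the target and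
  \<open>face X 1\<close> the source.\<close>

definition face :: "'u simp_cat \<Rightarrow> nat \<Rightarrow> 'u sfun" where
  "face X i = FAr X (0, \<lambda>_ \<in> {..0}. 1 - i, 1)"

definition edge :: "nat \<Rightarrow> nat \<Rightarrow> darr" where
  "edge k j = (1, \<lambda>i \<in> {..1}. if i = 0 then j - 1 else j, k)"

text \<open>
  For functors \<open>s, t : A \<rightarrow> B\<close>, the pullback of \<open>k\<close> copies of \<open>A\<close> over \<open>B\<close>: lists
  \<open>[x\<^sub>1, \<dots>, x\<^sub>k]\<close> with \<open>t x\<^sub>j = s x\<^bsub>j+1\<^esub>\<close>, for objects as well as for arrows.
\<close>

definition iterated_pullback ::
  "nat \<Rightarrow> ('o1, 'a1, 'o2, 'a2) ftor \<Rightarrow> ('o1, 'a1, 'o2, 'a2) ftor \<Rightarrow> ('o1 list, 'a1 list) category"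
  where
  "iterated_pullback k s t = mk_category
     {xs. length xs = k \<and> set xs \<subseteq> Obj (Src s) \<and>
          (\<forall>j. Suc j < k \<longrightarrow> FOb t (xs ! j) = FOb s (xs ! Suc j))}
     {fs. length fs = k \<and> set fs \<subseteq> Arr (Src s) \<and>
          (\<forall>j. Suc j < k \<longrightarrow> FAr t (fs ! j) = FAr s (fs ! Suc j))}
     (map (Dom (Src s))) (map (Cod (Src s))) (map (Id (Src s))) (map2 (Cmp (Src s)))"

definition segal_map :: "'u simp_cat \<Rightarrow> nat \<Rightarrow> ('u, 'u, 'u list, 'u list) ftor" where
  "segal_map X k = mk_functor (FOb X k) (iterated_pullback k (face X 1) (face X 0))
     (\<lambda>x. map (\<lambda>j. FOb (FAr X (edge k j)) x) [1..<Suc k])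
     (\<lambda>f. map (\<lambda>j. FAr (FAr X (edge k j)) f) [1..<Suc k])"

definition Ta2 :: "('u simp_cat, 'u simp_map) category" where
  "Ta2 = full_subcategory SimpCat
     {X. discrete (FOb X 0) \<and> (\<forall>k \<ge> 2. is_equivalence (segal_map X k))}"


section \<open>Pseudo-natural transformations\<close>

text \<open>
  \<open>PCell r f\<close>, for \<open>f : c \<rightarrow> d\<close>, is the invertible 2-cell \<open>G f \<circ> r\<^sub>c \<Rightarrow> r\<^sub>d \<circ> F f\<close>.  Since the
  domain has only identity 2-cells, the remaining axioms are compatibility with identities
  and composition.
\<close>

record ('o, 'a, 'u) pseudo =
  PSrc :: "('o, 'a, 'u scat, 'u sfun) ftor"
  PTgt :: "('o, 'a, 'u scat, 'u sfun) ftor"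
  PFun :: "'o \<Rightarrow> 'u sfun"
  PCell :: "'a \<Rightarrow> ('u, 'u, 'u, 'u) ntrans"

locale pseudo_nat_trans = psrc: is_functor "PSrc r" + ptgt: is_functor "PTgt r"
  for r :: "('o, 'a, 'u) pseudo" +
  assumes psrc_Cat: "Tgt (PSrc r) = Cat"
    and ptgt_Cat: "Tgt (PTgt r) = Cat"
    and same_src: "Src (PTgt r) = Src (PSrc r)"
    and pfun: "c \<in> Obj (Src (PSrc r)) \<Longrightarrow>
          PFun r c \<in> hom Cat (FOb (PSrc r) c) (FOb (PTgt r) c)"
    and pcell: "f \<in> hom (Src (PSrc r)) c d \<Longrightarrow>
          nat_iso (PCell r f) \<and>
          NSrc (PCell r f) = FAr (PTgt r) f \<circ>\<^sub>F PFun r c \<and>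
          NTgt (PCell r f) = PFun r d \<circ>\<^sub>F FAr (PSrc r) f"
    and pcell_id: "c \<in> Obj (Src (PSrc r)) \<Longrightarrow> x \<in> Obj (FOb (PSrc r) c) \<Longrightarrow>
          NCmp (PCell r (Id (Src (PSrc r)) c)) x = Id (FOb (PTgt r) c) (FOb (PFun r c) x)"
    and pcell_cmp: "f \<in> hom (Src (PSrc r)) c d \<Longrightarrow> g \<in> hom (Src (PSrc r)) d e \<Longrightarrow>
          x \<in> Obj (FOb (PSrc r) c) \<Longrightarrow>
          NCmp (PCell r (Cmp (Src (PSrc r)) g f)) x =
          Cmp (FOb (PTgt r) e)
            (NCmp (PCell r g) (FOb (FAr (PSrc r) f) x))
            (FAr (FAr (PTgt r) g) (NCmp (PCell r f) x))"

definition levelwise_equivalence :: "('o, 'a, 'u) pseudo \<Rightarrow> bool" where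
  "levelwise_equivalence r \<longleftrightarrow> (\<forall>c \<in> Obj (Src (PSrc r)). is_equivalence (PFun r c))"

text \<open>
  A functor \<open>p : Y\<^sub>0 \<rightarrow> B\<close> induces a functor from the pullback of copies of \<open>Y\<^sub>1\<close> over \<open>Y\<^sub>0\<close>
  to the pullback over \<open>B\<close>; it commutes with all projections to \<open>Y\<^sub>1\<close>, hence is the identity
  on lists.
\<close>

definition base_change :: "'u simp_cat \<Rightarrow> 'u sfun \<Rightarrow> nat \<Rightarrow> ('u list, 'u list, 'u list, 'u list) ftor"
  where
  "base_change Y p n = mk_functor
     (iterated_pullback n (face Y 1) (face Y 0))
     (iterated_pullback n (p \<circ>\<^sub>F face Y 1) (p \<circ>\<^sub>F face Y 0))
     (\<lambda>xs. xs) (\<lambda>fs. fs)"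

end

theory Submission
  imports Defs "HOL-Library.Countable_Set"
begin

text \<open>
  Let \<open>(RX)\<^sub>k\<close> have as objects the pairs \<open>(f : [k] \<rightarrow> [m], x \<in> X\<^sub>m)\<close> and as arrows
  \<open>(f, x) \<rightarrow> (g, y)\<close> the arrows \<open>f\<^sup>*x \<rightarrow> g\<^sup>*y\<close> of \<open>X\<^sub>k\<close>; a map \<open>h\<close> of \<open>\<Delta>\<close> acts by \<open>(f, x) \<mapsto> (f \<circ> h, x)\<close>.
  Then \<open>(f, x) \<mapsto> f\<^sup>*x\<close> is a strictly natural map \<open>RX \<rightarrow> X\<close>, fully faithful by construction and
  surjective on objects because of the pairs \<open>(id, x)\<close>.  A chain of \<open>k\<close> objects of \<open>(RX)\<^sub>1\<close> matching
  over \<open>(RX)\<^sub>0\<close> consists of edges over a common \<open>x\<close> that fit together to a unique \<open>f : [k] \<rightarrow> [m]\<close>, so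
  the Segal map of \<open>RX\<close> is bijective on objects; it is bijective on arrows because the Segal map
  of \<open>X\<close> is fully faithful.  The functor in c) is fully faithful, and it is essentially surjective
  because the Segal map of \<open>X\<close> is.
\<close>

section \<open>Categories and functors\<close>

text \<open>The obstacle is strictness. The Segal maps of \<open>X\<close> are only equivalences, so
  a chain of edges is the spine of a simplex only up to isomorphism, and chosen simplices would have
  faces that agree only up to isomorphism. The resolution keeps simplices formal: its objects form
  the disjoint union, over all \<open>m\<close> and all objects of level \<open>m\<close>, of
  standard \<open>m\<close>-simplices. A standard simplex is the nerve of a total order, so its
  Segal maps are bijections. The disjoint union inherits this for chains of positive length, since
  consecutive edges share a vertex and hence lie in one copy. Homs are pulled back from
  \<open>X\<close>, which keeps each level equivalent to that of \<open>X\<close>.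

  Restriction only changes the map of \<open>Delta\<close>, so strict identities survive and the
  2-cells can be identities. Part c) still needs an argument: different nodes may evaluate to the
  same object of level 0, so the pullback over \<open>X\<close> admits more chains.

  The disjoint union must again live in the universe \<open>'u\<close>; as \<open>Delta\<close> has
  countably many arrows, an infinite universe has room for it.\<close>

lemma mk_category_simps [simp]:
  "Obj (mk_category Ob Ar d c i m) = Ob"
  "Arr (mk_category Ob Ar d c i m) = Ar"
  "f \<in> Ar \<Longrightarrow> Dom (mk_category Ob Ar d c i m) f = d f"
  "f \<in> Ar \<Longrightarrow> Cod (mk_category Ob Ar d c i m) f = c f"
  "x \<in> Ob \<Longrightarrow> Id (mk_category Ob Ar d c i m) x = i x"
  "g \<in> Ar \<Longrightarrow> f \<in> Ar \<Longrightarrow> d g = c f \<Longrightarrow> Cmp (mk_category Ob Ar d c i m) g f = m g f"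
  by (auto simp: mk_category_def)

lemma composable_mk_category [simp]:
  "composable (mk_category Ob Ar d c i m) g f \<longleftrightarrow> g \<in> Ar \<and> f \<in> Ar \<and> d g = c f"
  by (auto simp: mk_category_def composable_def)

lemma hom_mk_category [simp]:
  "hom (mk_category Ob Ar d c i m) x y = {f \<in> Ar. d f = x \<and> c f = y}"
  by (auto simp: mk_category_def hom_def)

text \<open>The extensionality axioms hold because \<open>mk_category\<close> cuts the structure
  maps down to their domains; what remains as premises is the algebra.\<close>

lemma category_mk_category:
  assumes "\<And>f. f \<in> Ar \<Longrightarrow> d f \<in> Ob" "\<And>f. f \<in> Ar \<Longrightarrow> c f \<in> Ob"
    and "\<And>x. x \<in> Ob \<Longrightarrow> i x \<in> Ar \<and> d (i x) = x \<and> c (i x) = x"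
    and "\<And>g f. g \<in> Ar \<Longrightarrow> f \<in> Ar \<Longrightarrow> d g = c f \<Longrightarrow> m g f \<in> Ar \<and> d (m g f) = d f \<and> c (m g f) = c g"
    and "\<And>f. f \<in> Ar \<Longrightarrow> m (i (c f)) f = f" "\<And>f. f \<in> Ar \<Longrightarrow> m f (i (d f)) = f"
    and "\<And>h g f. h \<in> Ar \<Longrightarrow> g \<in> Ar \<Longrightarrow> f \<in> Ar \<Longrightarrow> d h = c g \<Longrightarrow> d g = c f \<Longrightarrow>
           m (m h g) f = m h (m g f)"
  shows "category (mk_category Ob Ar d c i m)"
proof
  fix g f assume "\<not> composable (mk_category Ob Ar d c i m) g f"
  then show "Cmp (mk_category Ob Ar d c i m) g f = undefined"
    by (auto simp: mk_category_def composable_def)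
qed (use assms in \<open>auto simp: mk_category_def hom_def composable_def\<close>)

lemma homI: "f \<in> Arr C \<Longrightarrow> Dom C f = x \<Longrightarrow> Cod C f = y \<Longrightarrow> f \<in> hom C x y"
  by (simp add: hom_def)

context category
begin

lemma hom_obj: "f \<in> hom C x y \<Longrightarrow> x \<in> Obj C" "f \<in> hom C x y \<Longrightarrow> y \<in> Obj C"
  using dom_obj cod_obj by (auto simp: hom_def)

lemma cmp_in_hom: "g \<in> hom C y z \<Longrightarrow> f \<in> hom C x y \<Longrightarrow> Cmp C g f \<in> hom C x z"
  using cmp_hom[of g f] by (auto simp: hom_def composable_def)

lemma cmp_id_left: "f \<in> hom C x y \<Longrightarrow> Cmp C (Id C y) f = f"
  using id_left[of f] by (auto simp: hom_def)

lemma cmp_id_right: "f \<in> hom C x y \<Longrightarrow> Cmp C f (Id C x) = f"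
  using id_right[of f] by (auto simp: hom_def)

lemma cmp_assoc: "h \<in> hom C y z \<Longrightarrow> g \<in> hom C x y \<Longrightarrow> f \<in> hom C w x \<Longrightarrow>
    Cmp C (Cmp C h g) f = Cmp C h (Cmp C g f)"
  using assoc[of h g f] by (auto simp: hom_def composable_def)

lemma iso_arrE:
  assumes "iso_arr C f" "f \<in> hom C x y"
  obtains g where "g \<in> hom C y x" "Cmp C g f = Id C x" "Cmp C f g = Id C y"
  using assms by (auto simp: iso_arr_def hom_def)

lemma iso_arrI:
  assumes "f \<in> hom C x y" "g \<in> hom C y x" "Cmp C g f = Id C x" "Cmp C f g = Id C y"
  shows "iso_arr C f"
  using assms by (auto simp: iso_arr_def hom_def)

lemma iso_arr_Id: "x \<in> Obj C \<Longrightarrow> iso_arr C (Id C x)"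
  by (rule iso_arrI[where g = "Id C x" and x = x and y = x]) (simp_all add: id_hom cmp_id_left[OF id_hom])

lemma category_op: "category (op_category C)"
proof
  fix h g f assume "composable (op_category C) h g" "composable (op_category C) g f"
  then show "Cmp (op_category C) (Cmp (op_category C) h g) f =
      Cmp (op_category C) h (Cmp (op_category C) g f)"
    by (simp add: composable_def op_category_def assoc)
next
  fix g f assume "composable (op_category C) g f"
  then show "Cmp (op_category C) g f \<in> hom (op_category C) (Dom (op_category C) f) (Cod (op_category C) g)"
    using cmp_hom[of f g] by (auto simp: composable_def op_category_def hom_def)
next
  fix g f assume "\<not> composable (op_category C) g f"
  then show "Cmp (op_category C) g f = undefined"
    using cmp_ext[of f g] by (auto simp: composable_def op_category_def)
qed (use id_hom in \<open>auto simp: op_category_def dom_obj cod_obj id_left id_right dom_ext cod_ext id_ext hom_def\<close>)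

lemma category_full_subcategory: "category (full_subcategory C S)"
  unfolding full_subcategory_def
proof (rule category_mk_category, goal_cases)
  case (4 g f)
  then show ?case using cmp_hom[of g f] by (auto simp: composable_def hom_def)
next
  case (7 h g f)
  then show ?case by (auto intro!: assoc simp: composable_def)
qed (use id_hom in \<open>auto simp: dom_obj cod_obj id_left id_right hom_def\<close>)

end

lemma mk_functor_simps [simp]:
  "Src (mk_functor A B F0 F1) = A" "Tgt (mk_functor A B F0 F1) = B"
  "x \<in> Obj A \<Longrightarrow> FOb (mk_functor A B F0 F1) x = F0 x"
  "f \<in> Arr A \<Longrightarrow> FAr (mk_functor A B F0 F1) f = F1 f"
  by (simp_all add: mk_functor_def)

lemma is_functor_mk_functor:
  assumes "category A" "category B"
    and "\<And>x. x \<in> Obj A \<Longrightarrow> F0 x \<in> Obj B"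
    and "\<And>f x y. f \<in> hom A x y \<Longrightarrow> F1 f \<in> hom B (F0 x) (F0 y)"
    and "\<And>x. x \<in> Obj A \<Longrightarrow> F1 (Id A x) = Id B (F0 x)"
    and "\<And>g f x y z. g \<in> hom A y z \<Longrightarrow> f \<in> hom A x y \<Longrightarrow> F1 (Cmp A g f) = Cmp B (F1 g) (F1 f)"
  shows "is_functor (mk_functor A B F0 F1)"
proof -
  interpret A: category A by fact
  interpret B: category B by fact
  have id: "Id A x \<in> Arr A" if "x \<in> Obj A" for x
    using A.id_hom[OF that] by (simp add: hom_def)
  have cmp: "Cmp A g f \<in> Arr A" if "composable A g f" for g f
    using A.cmp_hom[OF that] by (simp add: hom_def)
  show ?thesis
  proof (intro is_functor.intro is_functor_axioms.intro)
    fix g f assume c: "composable (Src (mk_functor A B F0 F1)) g f"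
    then have "g \<in> hom A (Dom A g) (Cod A g)" "f \<in> hom A (Dom A f) (Dom A g)"
      by (auto simp: composable_def hom_def)
    from assms(6)[OF this] c cmp[of g f]
    show "FAr (mk_functor A B F0 F1) (Cmp (Src (mk_functor A B F0 F1)) g f) =
      Cmp (Tgt (mk_functor A B F0 F1)) (FAr (mk_functor A B F0 F1) g) (FAr (mk_functor A B F0 F1) f)"
      by (simp add: composable_def)
  next
    fix f assume "f \<in> Arr (Src (mk_functor A B F0 F1))"
    then show "FAr (mk_functor A B F0 F1) f
      \<in> hom (Tgt (mk_functor A B F0 F1))
          (FOb (mk_functor A B F0 F1) (Dom (Src (mk_functor A B F0 F1)) f))
          (FOb (mk_functor A B F0 F1) (Cod (Src (mk_functor A B F0 F1)) f))"
      using assms(4)[of f "Dom A f" "Cod A f"] A.dom_obj A.cod_obj by (simp add: homI)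
  qed (use assms id in \<open>auto simp: mk_functor_def\<close>)
qed

context is_functor
begin

lemma ar_hom: "f \<in> hom (Src F) x y \<Longrightarrow> FAr F f \<in> hom (Tgt F) (FOb F x) (FOb F y)"
  using ar by (auto simp: hom_def)

lemma ar_cmp: "g \<in> hom (Src F) y z \<Longrightarrow> f \<in> hom (Src F) x y \<Longrightarrow>
    FAr F (Cmp (Src F) g f) = Cmp (Tgt F) (FAr F g) (FAr F f)"
  by (rule pres_cmp) (auto simp: hom_def composable_def)

lemma ar_Arr: "f \<in> Arr (Src F) \<Longrightarrow> FAr F f \<in> Arr (Tgt F)"
  "f \<in> Arr (Src F) \<Longrightarrow> Dom (Tgt F) (FAr F f) = FOb F (Dom (Src F) f)"
  "f \<in> Arr (Src F) \<Longrightarrow> Cod (Tgt F) (FAr F f) = FOb F (Cod (Src F) f)"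
  using ar by (auto simp: hom_def)

end

text \<open>Off their domains both maps are \<open>undefined\<close>, so agreement on objects and
  arrows gives equality of records. Strict identities between functors, such as the laws of
  \<open>Cat\<close> and of \<open>res\<close>, rest on this.\<close>

lemma functor_eqI:
  fixes F G :: "('o1, 'a1, 'o2, 'a2) ftor"
  assumes "is_functor F" "is_functor G" "Src F = Src G" "Tgt F = Tgt G"
    and "\<And>x. x \<in> Obj (Src G) \<Longrightarrow> FOb F x = FOb G x"
    and "\<And>f. f \<in> Arr (Src G) \<Longrightarrow> FAr F f = FAr G f"
  shows "F = G"
proof -
  interpret F: is_functor F by fact
  interpret G: is_functor G by fact
  have "FOb F = FOb G"
    by (rule extensionalityI[OF F.ob_ext]) (use assms G.ob_ext in auto)
  moreover have "FAr F = FAr G"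
    by (rule extensionalityI[OF F.ar_ext]) (use assms G.ar_ext in auto)
  ultimately show ?thesis using assms(3,4) by (intro ftor.equality) auto
qed

lemma id_functor_simps [simp]:
  "Src (id_functor A) = A" "Tgt (id_functor A) = A"
  "x \<in> Obj A \<Longrightarrow> FOb (id_functor A) x = x" "f \<in> Arr A \<Longrightarrow> FAr (id_functor A) f = f"
  by (simp_all add: id_functor_def)

lemma comp_functor_simps [simp]:
  "Src (G \<circ>\<^sub>F F) = Src F" "Tgt (G \<circ>\<^sub>F F) = Tgt G"
  "x \<in> Obj (Src F) \<Longrightarrow> FOb (G \<circ>\<^sub>F F) x = FOb G (FOb F x)"
  "f \<in> Arr (Src F) \<Longrightarrow> FAr (G \<circ>\<^sub>F F) f = FAr G (FAr F f)"
  by (simp_all add: comp_functor_def)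

lemma is_functor_id_functor: "category A \<Longrightarrow> is_functor (id_functor A)"
  unfolding id_functor_def by (rule is_functor_mk_functor) auto

lemma is_functor_comp_functor:
  assumes "is_functor F" "is_functor G" "Tgt F = Src G"
  shows "is_functor (G \<circ>\<^sub>F F)"
proof -
  interpret F: is_functor F by fact
  interpret G: is_functor G by fact
  note F' = F.ob[unfolded assms(3)] F.ar_hom[unfolded assms(3)] F.pres_id[unfolded assms(3)]
  show ?thesis unfolding comp_functor_def
  proof (rule is_functor_mk_functor)
    fix g f x y z assume gf: "g \<in> hom (Src F) y z" "f \<in> hom (Src F) x y"
    then show "(FAr G \<circ> FAr F) (Cmp (Src F) g f) = Cmp (Tgt G) ((FAr G \<circ> FAr F) g) ((FAr G \<circ> FAr F) f)"
      using F.ar_cmp[OF gf] F.ar_hom[OF gf(1)] F.ar_hom[OF gf(2)] assms(3) G.ar_cmp by simp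
  qed (auto simp: F' G.ob G.ar_hom G.pres_id F.source.category_axioms G.target.category_axioms)
qed

lemma category_Cat: "category Cat"
  unfolding Cat_def
proof (rule category_mk_category, goal_cases)
  case (1 f)
  then interpret is_functor f by simp
  show ?case by (simp add: source.category_axioms)
next
  case (2 f)
  then interpret is_functor f by simp
  show ?case by (simp add: target.category_axioms)
next
  case (5 f)
  then interpret is_functor f by simp
  show ?case using 5
    by (intro functor_eqI is_functor_comp_functor is_functor_id_functor)
      (auto simp: ob ar_Arr target.category_axioms)
next
  case (6 f)
  then interpret is_functor f by simp
  show ?case using 6
    by (intro functor_eqI is_functor_comp_functor is_functor_id_functor)
      (auto simp: ob ar_Arr source.category_axioms)
next
  case (7 h g f)
  then interpret f: is_functor f by simp
  from 7 show ?case
    by (intro functor_eqI is_functor_comp_functor) (auto simp: f.ob f.ar_Arr)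
qed (auto simp: is_functor_id_functor is_functor_comp_functor)

lemma Cat_simps [simp]:
  "Obj Cat = {C. category C}" "Arr Cat = {F. is_functor F}"
  "hom Cat A B = {F. is_functor F \<and> Src F = A \<and> Tgt F = B}"
  "is_functor F \<Longrightarrow> Dom Cat F = Src F" "is_functor F \<Longrightarrow> Cod Cat F = Tgt F"
  "category C \<Longrightarrow> Id Cat C = id_functor C"
  "is_functor G \<Longrightarrow> is_functor F \<Longrightarrow> Src G = Tgt F \<Longrightarrow> Cmp Cat G F = G \<circ>\<^sub>F F"
  by (simp_all add: Cat_def)

section \<open>Functor categories and the simplex category\<close>

context nat_trans
begin

lemma naturality_hom: "f \<in> hom (Src (NSrc t)) x y \<Longrightarrow>
    Cmp (Tgt (NSrc t)) (NCmp t y) (FAr (NSrc t) f) = Cmp (Tgt (NSrc t)) (FAr (NTgt t) f) (NCmp t x)"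
  using naturality[of f] by (auto simp: hom_def)

end

lemma nat_transI:
  assumes "is_functor F" "is_functor G" "Src F = A" "Src G = A" "Tgt F = B" "Tgt G = B"
    and "\<And>x. x \<in> Obj A \<Longrightarrow> c x \<in> hom B (FOb F x) (FOb G x)"
    and "\<And>f x y. f \<in> hom A x y \<Longrightarrow> Cmp B (c y) (FAr F f) = Cmp B (FAr G f) (c x)"
  shows "nat_trans \<lparr> NSrc = F, NTgt = G, NCmp = restrict c (Obj A) \<rparr>"
proof -
  interpret F: is_functor F by fact
  show ?thesis
  proof (intro nat_trans.intro nat_trans_axioms.intro, simp_all only: ntrans.simps assms(1-6))
    fix f assume f: "f \<in> Arr A"
    then have "f \<in> hom A (Dom A f) (Cod A f)" by (simp add: hom_def)
    from assms(8)[OF this] f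
    show "Cmp B (restrict c (Obj A) (Cod A f)) (FAr F f) = Cmp B (FAr G f) (restrict c (Obj A) (Dom A f))"
      using F.source.dom_obj F.source.cod_obj assms(3) by simp
  qed (use assms(7) in auto)
qed

lemma nat_trans_id:
  assumes "is_functor F"
  shows "nat_trans \<lparr> NSrc = F, NTgt = F, NCmp = (\<lambda>x \<in> Obj (Src F). Id (Tgt F) (FOb F x)) \<rparr>"
proof -
  interpret is_functor F by fact
  show ?thesis
    by (rule nat_transI)
      (auto simp: assms ob target.id_hom ar_hom target.cmp_id_left[OF ar_hom] target.cmp_id_right[OF ar_hom])
qed

lemma nat_trans_comp:
  assumes "nat_trans t" "nat_trans u" "NTgt t = NSrc u"
  shows "nat_trans \<lparr> NSrc = NSrc t, NTgt = NTgt u,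
    NCmp = (\<lambda>x \<in> Obj (Src (NSrc t)). Cmp (Tgt (NSrc t)) (NCmp u x) (NCmp t x)) \<rparr>"
proof -
  interpret t: nat_trans t by fact
  interpret u: nat_trans u by fact
  let ?A = "Src (NSrc t)" and ?B = "Tgt (NSrc t)"
  have eqs: "Src (NSrc u) = ?A" "Src (NTgt u) = ?A" "Tgt (NSrc u) = ?B" "Tgt (NTgt u) = ?B"
    using t.src_eq u.src_eq t.tgt_eq u.tgt_eq assms(3) by auto
  have tc: "NCmp t x \<in> hom ?B (FOb (NSrc t) x) (FOb (NTgt t) x)"
    and uc: "NCmp u x \<in> hom ?B (FOb (NTgt t) x) (FOb (NTgt u) x)" if "x \<in> Obj ?A" for x
    using that t.component[of x] u.component[of x] by (auto simp: eqs assms(3))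
  show ?thesis
  proof (rule nat_transI)
    fix f x y assume f: "f \<in> hom ?A x y"
    then have xy: "x \<in> Obj ?A" "y \<in> Obj ?A" using t.nsrc.source.hom_obj by auto
    have Ff: "FAr (NSrc t) f \<in> hom ?B (FOb (NSrc t) x) (FOb (NSrc t) y)"
      using f by (rule t.nsrc.ar_hom)
    have Gf: "FAr (NTgt t) f \<in> hom ?B (FOb (NTgt t) x) (FOb (NTgt t) y)"
      using t.ntgt.ar_hom[of f x y] f by (simp add: assms(3) eqs)
    have Hf: "FAr (NTgt u) f \<in> hom ?B (FOb (NTgt u) x) (FOb (NTgt u) y)"
      using u.ntgt.ar_hom[of f x y] f by (simp add: eqs)
    note a = t.nsrc.target.cmp_assoc
    have "Cmp ?B (Cmp ?B (NCmp u y) (NCmp t y)) (FAr (NSrc t) f)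
        = Cmp ?B (NCmp u y) (Cmp ?B (FAr (NTgt t) f) (NCmp t x))"
      using a[OF uc[OF xy(2)] tc[OF xy(2)] Ff] t.naturality_hom[OF f] by simp
    also have "\<dots> = Cmp ?B (Cmp ?B (FAr (NTgt u) f) (NCmp u x)) (NCmp t x)"
      using a[OF uc[OF xy(2)] Gf tc[OF xy(1)]] u.naturality_hom[of f x y] f
      by (simp add: eqs assms(3))
    also have "\<dots> = Cmp ?B (FAr (NTgt u) f) (Cmp ?B (NCmp u x) (NCmp t x))"
      by (rule a[OF Hf uc[OF xy(1)] tc[OF xy(1)]])
    finally show "Cmp ?B (Cmp ?B (NCmp u y) (NCmp t y)) (FAr (NSrc t) f)
      = Cmp ?B (FAr (NTgt u) f) (Cmp ?B (NCmp u x) (NCmp t x))" .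
  qed (auto simp: eqs t.nsrc.is_functor_axioms u.ntgt.is_functor_axioms
      intro: t.nsrc.target.cmp_in_hom uc tc)
qed

text \<open>All laws hold componentwise in \<open>B\<close>; for the unit laws,
  \<open>component_ext\<close> turns agreement of components into equality of records.\<close>

lemma category_functor_category:
  fixes A :: "('a, 'b) category" and B :: "('c, 'd) category"
  assumes "category A" "category B"
  shows "category (functor_category A B)"
proof -
  interpret B: category B by fact
  have F: "is_functor (NSrc t) \<and> is_functor (NTgt t) \<and> Src (NTgt t) = Src (NSrc t) \<and> Tgt (NTgt t) = Tgt (NSrc t)"
    if "nat_trans t" for t :: "('a, 'b, 'c, 'd) ntrans"
  proof -
    interpret nat_trans t by fact
    show ?thesis by (simp add: nsrc.is_functor_axioms ntgt.is_functor_axioms src_eq tgt_eq)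
  qed
  show ?thesis unfolding functor_category_def
  proof (rule category_mk_category, goal_cases)
    case (3 F)
    then show ?case using nat_trans_id[of F] by auto
  next
    case (4 u t)
    then show ?case using nat_trans_comp[of t u] by auto
  next
    case (5 t)
    then interpret t: nat_trans t by simp
    have c: "Cmp B (Id B (FOb (NTgt t) x)) (NCmp t x) = NCmp t x" if "x \<in> Obj A" for x
      using B.cmp_id_left t.component[of x] that 5 by auto
    show ?case using 5 t.component_ext
      by (intro ntrans.equality) (auto simp: c extensional_restrict cong: restrict_cong)
  next
    case (6 t)
    then interpret t: nat_trans t by simp
    have c: "Cmp B (NCmp t x) (Id B (FOb (NSrc t) x)) = NCmp t x" if "x \<in> Obj A" for x
      using B.cmp_id_right t.component[of x] that 6 by auto
    show ?case using 6 t.component_ext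
      by (intro ntrans.equality) (auto simp: c extensional_restrict cong: restrict_cong)
  next
    case (7 h g f)
    interpret h: nat_trans h using 7 by simp
    interpret g: nat_trans g using 7 by simp
    interpret f: nat_trans f using 7 by simp
    have "Cmp B (Cmp B (NCmp h x) (NCmp g x)) (NCmp f x) =
      Cmp B (NCmp h x) (Cmp B (NCmp g x) (NCmp f x))" if "x \<in> Obj A" for x
      using B.cmp_assoc[of "NCmp h x" _ _ "NCmp g x" _ "NCmp f x"]
        h.component[of x] g.component[of x] f.component[of x] that 7 by auto
    then show ?case by (auto cong: restrict_cong)
  qed (use F in auto)
qed

lemma category_Delta: "category Delta"
  unfolding Delta_def
proof (rule category_mk_category, goal_cases)
  case (4 g f)
  obtain n h p where g: "g = (n, h, p)" by (cases g)
  obtain m k n' where f: "f = (m, k, n')" by (cases f)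
  have k: "k i \<le> n" if "i \<le> m" for i using 4 that by (auto simp: f g PiE_def Pi_def)
  have h: "h i \<le> p" if "i \<le> n" for i using 4 that by (auto simp: f g PiE_def Pi_def)
  have "mono_on {..m} (compose {..m} h k)"
    unfolding compose_def using 4 k by (auto simp: f g mono_on_def)
  then show ?case using 4 k h by (auto simp: f g compose_def)
next
  case (5 f) then show ?case by (auto simp: compose_def PiE_def Pi_def extensional_def fun_eq_iff)
next
  case (6 f) then show ?case by (auto simp: compose_def PiE_def Pi_def extensional_def fun_eq_iff)
next
  case (7 h g f)
  then show ?case by (auto simp: compose_def PiE_def Pi_def extensional_def fun_eq_iff)
qed (auto simp: mono_on_def)

lemma Obj_Delta [simp]: "Obj Delta = UNIV"
  by (simp add: Delta_def)

lemma Delta_simps: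
  "Arr Delta = {(m, f, n). f \<in> {..m} \<rightarrow>\<^sub>E {..n} \<and> mono_on {..m} f}"
  "(m, f, n) \<in> Arr Delta \<Longrightarrow> Dom Delta (m, f, n) = m"
  "(m, f, n) \<in> Arr Delta \<Longrightarrow> Cod Delta (m, f, n) = n"
  "(n, g, p) \<in> Arr Delta \<Longrightarrow> (m, f, n) \<in> Arr Delta \<Longrightarrow>
    Cmp Delta (n, g, p) (m, f, n) = (m, compose {..m} g f, p)"
  unfolding Delta_def by simp_all

lemma hom_Delta:
  "hom Delta m n = {(m', f, n'). m' = m \<and> n' = n \<and> f \<in> {..m} \<rightarrow>\<^sub>E {..n} \<and> mono_on {..m} f}"
  unfolding Delta_def by auto

lemma op_category_simps [simp]:
  "Obj (op_category C) = Obj C" "Arr (op_category C) = Arr C" "Dom (op_category C) = Cod C"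
  "Cod (op_category C) = Dom C" "Id (op_category C) = Id C" "Cmp (op_category C) g f = Cmp C f g"
  "hom (op_category C) x y = hom C y x"
  by (auto simp: op_category_def hom_def)

lemmas category_Delta_op = category.category_op[OF category_Delta]

section \<open>Equivalences and isomorphisms\<close>

definition fully_faithful :: "('o1, 'a1, 'o2, 'a2) ftor \<Rightarrow> bool" where
  "fully_faithful F \<longleftrightarrow> (\<forall>x \<in> Obj (Src F). \<forall>y \<in> Obj (Src F).
     bij_betw (FAr F) (hom (Src F) x y) (hom (Tgt F) (FOb F x) (FOb F y)))"

definition essentially_surjective :: "('o1, 'a1, 'o2, 'a2) ftor \<Rightarrow> bool" where
  "essentially_surjective F \<longleftrightarrow>
     (\<forall>y \<in> Obj (Tgt F). \<exists>x \<in> Obj (Src F). \<exists>g \<in> hom (Tgt F) (FOb F x) y. iso_arr (Tgt F) g)"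

lemma naturally_isomorphicE:
  assumes "naturally_isomorphic F G"
  obtains e e' where
    "\<And>x. x \<in> Obj (Src F) \<Longrightarrow> e x \<in> hom (Tgt F) (FOb F x) (FOb G x)"
    "\<And>x. x \<in> Obj (Src F) \<Longrightarrow> e' x \<in> hom (Tgt F) (FOb G x) (FOb F x)"
    "\<And>x. x \<in> Obj (Src F) \<Longrightarrow> Cmp (Tgt F) (e' x) (e x) = Id (Tgt F) (FOb F x)"
    "\<And>x. x \<in> Obj (Src F) \<Longrightarrow> Cmp (Tgt F) (e x) (e' x) = Id (Tgt F) (FOb G x)"
    "\<And>f x y. f \<in> hom (Src F) x y \<Longrightarrow> Cmp (Tgt F) (e y) (FAr F f) = Cmp (Tgt F) (FAr G f) (e x)"
proof -
  obtain t where t: "nat_iso t" "NSrc t = F" "NTgt t = G"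
    using assms by (auto simp: naturally_isomorphic_def)
  interpret nat_trans t using t by (simp add: nat_iso_def)
  have "\<exists>g. g \<in> hom (Tgt F) (FOb G x) (FOb F x) \<and> Cmp (Tgt F) g (NCmp t x) = Id (Tgt F) (FOb F x)
      \<and> Cmp (Tgt F) (NCmp t x) g = Id (Tgt F) (FOb G x)" if "x \<in> Obj (Src F)" for x
    using that t nsrc.target.iso_arrE[OF _ component[of x]] by (auto simp: nat_iso_def)
  then obtain e' where "\<And>x. x \<in> Obj (Src F) \<Longrightarrow> e' x \<in> hom (Tgt F) (FOb G x) (FOb F x) \<and>
      Cmp (Tgt F) (e' x) (NCmp t x) = Id (Tgt F) (FOb F x) \<and>
      Cmp (Tgt F) (NCmp t x) (e' x) = Id (Tgt F) (FOb G x)" by metis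
  then show thesis using that[of "NCmp t" e'] component naturality_hom t by auto
qed

lemma naturally_isomorphicI:
  assumes "is_functor F" "is_functor G" "Src F = A" "Src G = A" "Tgt F = B" "Tgt G = B"
    and "\<And>x. x \<in> Obj A \<Longrightarrow> c x \<in> hom B (FOb F x) (FOb G x)"
    and "\<And>x. x \<in> Obj A \<Longrightarrow> iso_arr B (c x)"
    and "\<And>f x y. f \<in> hom A x y \<Longrightarrow> Cmp B (c y) (FAr F f) = Cmp B (FAr G f) (c x)"
  shows "naturally_isomorphic F G"
  unfolding naturally_isomorphic_def nat_iso_def
  using nat_transI[of F G A B c] assms
  by (intro exI[of _ "\<lparr> NSrc = F, NTgt = G, NCmp = restrict c (Obj A) \<rparr>"]) auto

lemma left_inverseE:
  assumes G: "Tgt G = Src F" and GF: "naturally_isomorphic (G \<circ>\<^sub>F F) (id_functor (Src F))"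
  obtains e e' where
    "\<And>x. x \<in> Obj (Src F) \<Longrightarrow> e x \<in> hom (Src F) (FOb G (FOb F x)) x"
    "\<And>x. x \<in> Obj (Src F) \<Longrightarrow> e' x \<in> hom (Src F) x (FOb G (FOb F x))"
    "\<And>x. x \<in> Obj (Src F) \<Longrightarrow> Cmp (Src F) (e' x) (e x) = Id (Src F) (FOb G (FOb F x))"
    "\<And>x. x \<in> Obj (Src F) \<Longrightarrow> Cmp (Src F) (e x) (e' x) = Id (Src F) x"
    "\<And>f x y. f \<in> hom (Src F) x y \<Longrightarrow>
       Cmp (Src F) (e y) (FAr G (FAr F f)) = Cmp (Src F) f (e x)"
proof (rule naturally_isomorphicE[OF GF], goal_cases)
  case (1 e e')
  show ?case
  proof (rule 1(1))
    show "Cmp (Src F) (e y) (FAr G (FAr F f)) = Cmp (Src F) f (e x)" if "f \<in> hom (Src F) x y" for f x y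
      using 1(6)[of f x y] that by (auto simp: G hom_def)
  qed (use 1(2-5) in \<open>auto simp: G\<close>)
qed

text \<open>Conjugation with the isomorphism from \<open>G\<close> after \<open>F\<close> to the
  identity recovers \<open>f\<close> from \<open>FAr G (FAr F f)\<close>. The inverse is one-sided
  so that the lemma can be used again with \<open>F\<close> and \<open>G\<close> exchanged, in the
  proof of fullness.\<close>

lemma faithful_if_left_inverse:
  assumes "is_functor F" "is_functor G" "Src G = Tgt F" "Tgt G = Src F"
    and "naturally_isomorphic (G \<circ>\<^sub>F F) (id_functor (Src F))"
    and "f \<in> hom (Src F) x y" "g \<in> hom (Src F) x y" "FAr F f = FAr F g"
  shows "f = g"
proof -
  interpret F: is_functor F by fact
  interpret G: is_functor G by fact
  let ?A = "Src F"
  have xy: "x \<in> Obj ?A" "y \<in> Obj ?A" using assms(6) F.source.hom_obj by auto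
  obtain e e' where e:
    "\<And>x. x \<in> Obj ?A \<Longrightarrow> e x \<in> hom ?A (FOb G (FOb F x)) x"
    "\<And>x. x \<in> Obj ?A \<Longrightarrow> e' x \<in> hom ?A x (FOb G (FOb F x))"
    "\<And>x. x \<in> Obj ?A \<Longrightarrow> Cmp ?A (e x) (e' x) = Id ?A x"
    "\<And>f x y. f \<in> hom ?A x y \<Longrightarrow> Cmp ?A (e y) (FAr G (FAr F f)) = Cmp ?A f (e x)"
    using left_inverseE[OF assms(4,5)] by metis
  have "h = Cmp ?A (Cmp ?A (e y) (FAr G (FAr F h))) (e' x)" if h: "h \<in> hom ?A x y" for h
  proof -
    have "Cmp ?A (Cmp ?A (e y) (FAr G (FAr F h))) (e' x) = Cmp ?A (Cmp ?A h (e x)) (e' x)"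
      using e(4)[OF h] by simp
    also have "\<dots> = Cmp ?A h (Cmp ?A (e x) (e' x))"
      using e(1,2)[OF xy(1)] h xy by (intro F.source.cmp_assoc) auto
    also have "\<dots> = h" using e(3)[OF xy(1)] xy F.source.cmp_id_right[OF h] by simp
    finally show ?thesis by simp
  qed
  from this[OF assms(6)] this[OF assms(7)] assms(8) show ?thesis by metis
qed

lemma is_equivalenceD:
  assumes "is_equivalence F"
  shows "is_functor F" "fully_faithful F" "essentially_surjective F"
proof -
  obtain G where F: "is_functor F" and G: "is_functor G" "Src G = Tgt F" "Tgt G = Src F"
    and GF: "naturally_isomorphic (G \<circ>\<^sub>F F) (id_functor (Src F))"
    and FG: "naturally_isomorphic (F \<circ>\<^sub>F G) (id_functor (Tgt F))"
    using assms by (auto simp: is_equivalence_def)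
  show "is_functor F" by fact
  interpret F: is_functor F by fact
  interpret G: is_functor G by fact
  let ?A = "Src F" and ?B = "Tgt F"
  obtain e e' where e:
    "\<And>x. x \<in> Obj ?A \<Longrightarrow> e x \<in> hom ?A (FOb G (FOb F x)) x"
    "\<And>x. x \<in> Obj ?A \<Longrightarrow> e' x \<in> hom ?A x (FOb G (FOb F x))"
    "\<And>x. x \<in> Obj ?A \<Longrightarrow> Cmp ?A (e' x) (e x) = Id ?A (FOb G (FOb F x))"
    "\<And>f x y. f \<in> hom ?A x y \<Longrightarrow> Cmp ?A (e y) (FAr G (FAr F f)) = Cmp ?A f (e x)"
    using left_inverseE[OF G(3) GF] by metis
  show "fully_faithful F" unfolding fully_faithful_def bij_betw_def
  proof (intro ballI conjI)
    fix x y assume xy: "x \<in> Obj ?A" "y \<in> Obj ?A"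
    show "inj_on (FAr F) (hom ?A x y)"
      by (rule inj_onI) (rule faithful_if_left_inverse[OF F G GF])
    have "g \<in> FAr F ` hom ?A x y" if g: "g \<in> hom ?B (FOb F x) (FOb F y)" for g
    proof -
      have Gg: "FAr G g \<in> hom ?A (FOb G (FOb F x)) (FOb G (FOb F y))"
        using G.ar_hom[of g] g G by simp
      \<comment> \<open>The candidate preimage of \<open>g\<close> is \<open>FAr G g\<close>
        conjugated by the isomorphism. It is shown that \<open>FAr F f\<close> and \<open>g\<close>
        agree after \<open>G\<close>, and \<open>G\<close> is faithful.\<close>
      define f where "f = Cmp ?A (Cmp ?A (e y) (FAr G g)) (e' x)"
      have eg: "Cmp ?A (e y) (FAr G g) \<in> hom ?A (FOb G (FOb F x)) y"
        using F.source.cmp_in_hom[OF e(1)[OF xy(2)] Gg] .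
      have f: "f \<in> hom ?A x y" unfolding f_def
        by (rule F.source.cmp_in_hom[OF eg e(2)[OF xy(1)]])
      have GFf: "FAr G (FAr F f) \<in> hom ?A (FOb G (FOb F x)) (FOb G (FOb F y))"
        using G.ar_hom[of "FAr F f"] F.ar_hom[OF f] G by simp
      have "Cmp ?A f (e x) = Cmp ?A (e y) (FAr G g)"
        unfolding f_def using F.source.cmp_assoc[OF eg e(2)[OF xy(1)] e(1)[OF xy(1)]]
          e(3)[OF xy(1)] F.source.cmp_id_right[OF eg] by simp
      then have "Cmp ?A (e y) (FAr G (FAr F f)) = Cmp ?A (e y) (FAr G g)"
        using e(4)[OF f] by simp
      then have "FAr G (FAr F f) = FAr G g"
        using F.source.cmp_assoc[OF e(2)[OF xy(2)] e(1)[OF xy(2)] GFf]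
          F.source.cmp_assoc[OF e(2)[OF xy(2)] e(1)[OF xy(2)] Gg] e(3)[OF xy(2)]
          F.source.cmp_id_left[OF Gg] F.source.cmp_id_left[OF GFf] by simp
      then have "FAr F f = g"
        using faithful_if_left_inverse[of G F "FAr F f" "FOb F x" "FOb F y" g] G F FG F.ar_hom[OF f] g
        by simp
      then show ?thesis using f by auto
    qed
    then show "FAr F ` hom ?A x y = hom ?B (FOb F x) (FOb F y)"
      using F.ar_hom by auto
  qed
  show "essentially_surjective F" unfolding essentially_surjective_def
  proof
    fix y assume y: "y \<in> Obj ?B"
    obtain t where t: "nat_iso t" "NSrc t = F \<circ>\<^sub>F G" "NTgt t = id_functor ?B"
      using FG by (auto simp: naturally_isomorphic_def)
    interpret t: nat_trans t using t by (simp add: nat_iso_def)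
    have "NCmp t y \<in> hom ?B (FOb F (FOb G y)) y" "iso_arr ?B (NCmp t y)"
      using t.component[of y] t y G by (auto simp: nat_iso_def)
    then show "\<exists>x \<in> Obj ?A. \<exists>g \<in> hom ?B (FOb F x) y. iso_arr ?B g"
      using G.ob[of y] y G by auto
  qed
qed

text \<open>Choice supplies for each \<open>y\<close> an object \<open>G0 y\<close> and an
  isomorphism \<open>e y\<close> from its image onto \<open>y\<close>. An arrow is sent to the lift
  along \<open>F\<close> of its conjugate by these isomorphisms, so the functor laws of the inverse
  can be checked after applying \<open>F\<close>, by faithfulness.\<close>

lemma is_equivalenceI:
  assumes F: "is_functor F" and ff: "fully_faithful F" and es: "essentially_surjective F"
  shows "is_equivalence F"
proof -
  interpret F: is_functor F by fact
  let ?A = "Src F" and ?B = "Tgt F"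
  have "\<exists>x g g'. x \<in> Obj ?A \<and> g \<in> hom ?B (FOb F x) y \<and> g' \<in> hom ?B y (FOb F x) \<and>
      Cmp ?B g' g = Id ?B (FOb F x) \<and> Cmp ?B g g' = Id ?B y" if "y \<in> Obj ?B" for y
    using es that F.target.iso_arrE unfolding essentially_surjective_def by metis
  then obtain G0 e e' where G0: "\<And>y. y \<in> Obj ?B \<Longrightarrow> G0 y \<in> Obj ?A"
    and e: "\<And>y. y \<in> Obj ?B \<Longrightarrow> e y \<in> hom ?B (FOb F (G0 y)) y"
    and e': "\<And>y. y \<in> Obj ?B \<Longrightarrow> e' y \<in> hom ?B y (FOb F (G0 y))"
    and e'e: "\<And>y. y \<in> Obj ?B \<Longrightarrow> Cmp ?B (e' y) (e y) = Id ?B (FOb F (G0 y))"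
    and ee': "\<And>y. y \<in> Obj ?B \<Longrightarrow> Cmp ?B (e y) (e' y) = Id ?B y"
    by metis
  have full: "\<exists>f \<in> hom ?A x y. FAr F f = g"
    if "x \<in> Obj ?A" "y \<in> Obj ?A" "g \<in> hom ?B (FOb F x) (FOb F y)" for x y g
    using ff that unfolding fully_faithful_def bij_betw_def by (metis imageE)
  have faithful: "f = f'"
    if "f \<in> hom ?A x y" "f' \<in> hom ?A x y" "FAr F f = FAr F f'" for x y f f'
    using ff that F.source.hom_obj[OF that(1)] unfolding fully_faithful_def bij_betw_def inj_on_def
    by blast
  define conj where "conj g = Cmp ?B (e' (Cod ?B g)) (Cmp ?B g (e (Dom ?B g)))" for g
  have conj_eq: "conj g = Cmp ?B (e' z) (Cmp ?B g (e y))" if "g \<in> hom ?B y z" for g y z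
    using that by (auto simp: conj_def hom_def)
  have conj_hom: "conj g \<in> hom ?B (FOb F (G0 y)) (FOb F (G0 z))" if "g \<in> hom ?B y z" for g y z
    unfolding conj_eq[OF that] using that F.target.hom_obj[OF that] e e'
    by (blast intro: F.target.cmp_in_hom)
  define G1 where "G1 g = (SOME f. f \<in> hom ?A (G0 (Dom ?B g)) (G0 (Cod ?B g)) \<and> FAr F f = conj g)" for g
  have G1: "G1 g \<in> hom ?A (G0 y) (G0 z) \<and> FAr F (G1 g) = conj g" if g: "g \<in> hom ?B y z" for g y z
  proof -
    have "\<exists>f. f \<in> hom ?A (G0 (Dom ?B g)) (G0 (Cod ?B g)) \<and> FAr F f = conj g"
      using full[OF _ _ conj_hom[OF g]] F.target.hom_obj[OF g] G0 g by (auto simp: hom_def)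
    from someI_ex[OF this, folded G1_def] g show ?thesis by (auto simp: hom_def)
  qed
  note assoc = F.target.cmp_assoc and cmp = F.target.cmp_in_hom
  have conj_e: "Cmp ?B (e z) (conj g) = Cmp ?B g (e y)" if g: "g \<in> hom ?B y z" for g y z
  proof -
    have yz: "y \<in> Obj ?B" "z \<in> Obj ?B" using F.target.hom_obj[OF g] .
    have ge: "Cmp ?B g (e y) \<in> hom ?B (FOb F (G0 y)) z" using cmp[OF g e[OF yz(1)]] .
    show ?thesis unfolding conj_eq[OF g]
      using assoc[OF e[OF yz(2)] e'[OF yz(2)] ge] ee'[OF yz(2)] F.target.cmp_id_left[OF ge] by simp
  qed
  \<comment> \<open>\<open>e y\<close> has the left inverse \<open>e' y\<close>, hence is left
    cancellable. That conjugation respects composition is then checked after composing both sides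
    with \<open>e z\<close>.\<close>
  have cancel: "u = v" if "y \<in> Obj ?B" "Cmp ?B (e y) u = Cmp ?B (e y) v"
    "u \<in> hom ?B x (FOb F (G0 y))" "v \<in> hom ?B x (FOb F (G0 y))" for u v x y
    using assoc[OF e'[OF that(1)] e[OF that(1)] that(3)] assoc[OF e'[OF that(1)] e[OF that(1)] that(4)]
      e'e[OF that(1)] that(2) F.target.cmp_id_left[OF that(3)] F.target.cmp_id_left[OF that(4)] by simp
  define G where "G = mk_functor ?B ?A G0 G1"
  have G: "is_functor G" unfolding G_def
  proof (rule is_functor_mk_functor)
    fix y assume y: "y \<in> Obj ?B"
    note i = F.target.id_hom[OF y]
    have "conj (Id ?B y) = Id ?B (FOb F (G0 y))"
      unfolding conj_eq[OF i] using F.target.cmp_id_left[OF e[OF y]] e'e[OF y] by simp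
    then show "G1 (Id ?B y) = Id ?A (G0 y)"
      using G1[OF i] F.source.id_hom[OF G0[OF y]] F.pres_id[OF G0[OF y]] by (metis faithful)
  next
    fix g f x y z assume g: "g \<in> hom ?B y z" and f: "f \<in> hom ?B x y"
    note gf = cmp[OF g f]
    have o: "x \<in> Obj ?B" "y \<in> Obj ?B" "z \<in> Obj ?B"
      using F.target.hom_obj g f by auto
    have "Cmp ?B (e z) (Cmp ?B (conj g) (conj f)) = Cmp ?B (Cmp ?B g (e y)) (conj f)"
      using assoc[OF e[OF o(3)] conj_hom[OF g] conj_hom[OF f]] conj_e[OF g] by simp
    also have "\<dots> = Cmp ?B g (Cmp ?B f (e x))"
      using assoc[OF g e[OF o(2)] conj_hom[OF f]] conj_e[OF f] by simp
    also have "\<dots> = Cmp ?B (e z) (conj (Cmp ?B g f))"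
      using assoc[OF g f e[OF o(1)]] conj_e[OF gf] by simp
    finally have "Cmp ?B (conj g) (conj f) = conj (Cmp ?B g f)"
      using cancel[OF o(3)] conj_hom[OF gf] cmp[OF conj_hom[OF g] conj_hom[OF f]] by blast
    then show "G1 (Cmp ?B g f) = Cmp ?A (G1 g) (G1 f)"
      using G1[OF gf] G1[OF g] G1[OF f] F.source.cmp_in_hom[of "G1 g" _ _ "G1 f"] F.ar_cmp[of "G1 g" _ _ "G1 f"]
      by (metis faithful)
  qed (use G0 G1 F.source.category_axioms F.target.category_axioms in auto)
  have GA: "FAr G g = G1 g" if "g \<in> hom ?B x y" for g x y
    using that by (simp add: G_def hom_def)
  have FGA: "FAr (F \<circ>\<^sub>F G) g = conj g" if "g \<in> hom ?B x y" for g x y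
    using that G1[OF that] by (simp add: G_def hom_def)
  have GFA: "FAr (G \<circ>\<^sub>F F) f = G1 (FAr F f)" if "f \<in> hom ?A x y" for f x y
    using that F.ar_hom[OF that] by (simp add: G_def hom_def)
  have G': "Src G = ?B" "Tgt G = ?A" by (simp_all add: G_def)
  have FG: "naturally_isomorphic (F \<circ>\<^sub>F G) (id_functor ?B)"
  proof (rule naturally_isomorphicI[where c = e])
    fix y assume y: "y \<in> Obj ?B"
    show "e y \<in> hom ?B (FOb (F \<circ>\<^sub>F G) y) (FOb (id_functor ?B) y)"
      using e[OF y] y by (simp add: G_def)
    show "iso_arr ?B (e y)"
      using F.target.iso_arrI[OF e[OF y] e'[OF y] e'e[OF y] ee'[OF y]] .
  next
    fix f x y assume "f \<in> hom ?B x y"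
    then show "Cmp ?B (e y) (FAr (F \<circ>\<^sub>F G) f) = Cmp ?B (FAr (id_functor ?B) f) (e x)"
      using conj_e[of f x y] FGA[of f x y] by (simp add: hom_def)
  qed (use G G' F in \<open>auto intro: is_functor_comp_functor is_functor_id_functor F.target.category_axioms\<close>)
  \<comment> \<open>The second isomorphism is obtained by lifting \<open>e\<close> and
    \<open>e'\<close> at \<open>FOb F x\<close> along \<open>F\<close>; its inverse laws and its
    naturality are inherited through faithfulness.\<close>
  have "\<exists>h h'. h \<in> hom ?A (G0 (FOb F x)) x \<and> h' \<in> hom ?A x (G0 (FOb F x)) \<and>
      FAr F h = e (FOb F x) \<and> FAr F h' = e' (FOb F x)" if "x \<in> Obj ?A" for x
    using full[of "G0 (FOb F x)" x "e (FOb F x)"] full[of x "G0 (FOb F x)" "e' (FOb F x)"]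
      G0 F.ob[OF that] e e' that by blast
  then obtain h h' where h: "\<And>x. x \<in> Obj ?A \<Longrightarrow> h x \<in> hom ?A (G0 (FOb F x)) x"
    and h': "\<And>x. x \<in> Obj ?A \<Longrightarrow> h' x \<in> hom ?A x (G0 (FOb F x))"
    and Fh: "\<And>x. x \<in> Obj ?A \<Longrightarrow> FAr F (h x) = e (FOb F x)"
    and Fh': "\<And>x. x \<in> Obj ?A \<Longrightarrow> FAr F (h' x) = e' (FOb F x)"
    by metis
  have GF: "naturally_isomorphic (G \<circ>\<^sub>F F) (id_functor ?A)"
  proof (rule naturally_isomorphicI[where c = h])
    fix x assume x: "x \<in> Obj ?A"
    note y = F.ob[OF x]
    show "h x \<in> hom ?A (FOb (G \<circ>\<^sub>F F) x) (FOb (id_functor ?A) x)"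
      using h[OF x] x y by (simp add: G_def)
    have 1: "Cmp ?A (h' x) (h x) = Id ?A (G0 (FOb F x))"
      using F.source.cmp_in_hom[OF h'[OF x] h[OF x]] F.source.id_hom[OF G0[OF y]]
        F.ar_cmp[OF h'[OF x] h[OF x]] Fh[OF x] Fh'[OF x] F.pres_id[OF G0[OF y]] e'e[OF y]
      by (metis faithful)
    have 2: "Cmp ?A (h x) (h' x) = Id ?A x"
      using F.source.cmp_in_hom[OF h[OF x] h'[OF x]] F.source.id_hom[OF x]
        F.ar_cmp[OF h[OF x] h'[OF x]] Fh[OF x] Fh'[OF x] F.pres_id[OF x] ee'[OF y]
      by (metis faithful)
    show "iso_arr ?A (h x)" by (rule F.source.iso_arrI[OF h[OF x] h'[OF x] 1 2])
  next
    fix f x y assume f: "f \<in> hom ?A x y"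
    have o: "x \<in> Obj ?A" "y \<in> Obj ?A" using F.source.hom_obj[OF f] .
    note Ff = F.ar_hom[OF f]
    have 1: "Cmp ?A (h y) (G1 (FAr F f)) \<in> hom ?A (G0 (FOb F x)) y"
      using F.source.cmp_in_hom[OF h[OF o(2)]] G1[OF Ff] by blast
    have 2: "Cmp ?A f (h x) \<in> hom ?A (G0 (FOb F x)) y"
      using F.source.cmp_in_hom[OF f h[OF o(1)]] .
    have "FAr F (Cmp ?A (h y) (G1 (FAr F f))) = FAr F (Cmp ?A f (h x))"
      using F.ar_cmp[OF h[OF o(2)]] F.ar_cmp[OF f h[OF o(1)]] G1[OF Ff] conj_e[OF Ff] Fh o by auto
    from faithful[OF 1 2 this] f
    show "Cmp ?A (h y) (FAr (G \<circ>\<^sub>F F) f) = Cmp ?A (FAr (id_functor ?A) f) (h x)"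
      unfolding GFA[OF f] by (simp add: hom_def)
  qed (use G G' F in \<open>auto intro: is_functor_comp_functor is_functor_id_functor F.source.category_axioms\<close>)
  show ?thesis unfolding is_equivalence_def using F G G' GF FG by blast
qed

text \<open>The inverses on objects and on arrows are chosen separately. They fit together because
  \<open>F\<close> is injective: on objects, which fixes the ends of \<open>G1 g\<close>, and on
  arrows, which fixes identities and composites.\<close>

lemma is_isomorphismI:
  assumes F: "is_functor F"
    and ob: "bij_betw (FOb F) (Obj (Src F)) (Obj (Tgt F))"
    and ar: "bij_betw (FAr F) (Arr (Src F)) (Arr (Tgt F))"
  shows "is_isomorphism F"
proof -
  interpret F: is_functor F by fact
  let ?A = "Src F" and ?B = "Tgt F"
  define G0 where "G0 = inv_into (Obj ?A) (FOb F)"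
  define G1 where "G1 = inv_into (Arr ?A) (FAr F)"
  have G0: "\<And>y. y \<in> Obj ?B \<Longrightarrow> G0 y \<in> Obj ?A \<and> FOb F (G0 y) = y" "\<And>x. x \<in> Obj ?A \<Longrightarrow> G0 (FOb F x) = x"
    using ob bij_betw_inv_into_right[OF ob] bij_betw_inv_into_left[OF ob] bij_betw_inv_into[OF ob]
    by (auto simp: G0_def bij_betw_def)
  have G1: "\<And>y. y \<in> Arr ?B \<Longrightarrow> G1 y \<in> Arr ?A \<and> FAr F (G1 y) = y" "\<And>x. x \<in> Arr ?A \<Longrightarrow> G1 (FAr F x) = x"
    using bij_betw_inv_into_right[OF ar] bij_betw_inv_into_left[OF ar] bij_betw_inv_into[OF ar]
    by (auto simp: G1_def bij_betw_def)
  have G1_hom: "G1 g \<in> hom ?A (G0 x) (G0 y)" if "g \<in> hom ?B x y" for g x y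
  proof -
    have "G1 g \<in> Arr ?A" "FAr F (G1 g) = g" using that G1 by (auto simp: hom_def)
    moreover from this have "FOb F (Dom ?A (G1 g)) = x" "FOb F (Cod ?A (G1 g)) = y"
      using F.ar_Arr(2,3)[of "G1 g"] that by (auto simp: hom_def)
    ultimately show ?thesis using G0(2) F.source.dom_obj F.source.cod_obj
      by (metis (mono_tags, lifting) homI)
  qed
  have "is_functor (mk_functor ?B ?A G0 G1)"
  proof (rule is_functor_mk_functor)
    fix x assume "x \<in> Obj ?B"
    then show "G1 (Id ?B x) = Id ?A (G0 x)"
      using F.pres_id[of "G0 x"] G0 G1(2)[of "Id ?A (G0 x)"] F.source.id_hom by (auto simp: hom_def)
  next
    fix g f x y z assume gf: "g \<in> hom ?B y z" "f \<in> hom ?B x y"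
    have "FAr F (Cmp ?A (G1 g) (G1 f)) = Cmp ?B g f"
      using F.ar_cmp[OF G1_hom[OF gf(1)] G1_hom[OF gf(2)]] G1(1) gf by (auto simp: hom_def)
    moreover have "Cmp ?A (G1 g) (G1 f) \<in> Arr ?A"
      using F.source.cmp_in_hom[OF G1_hom[OF gf(1)] G1_hom[OF gf(2)]] by (simp add: hom_def)
    ultimately show "G1 (Cmp ?B g f) = Cmp ?A (G1 g) (G1 f)" using G1(2) by metis
  qed (use G0 G1_hom F.source.category_axioms F.target.category_axioms in auto)
  moreover from this have "mk_functor ?B ?A G0 G1 \<circ>\<^sub>F F = id_functor ?A" "F \<circ>\<^sub>F mk_functor ?B ?A G0 G1 = id_functor ?B"
    using F G0 G1 F.ob F.ar_Arr
    by (auto intro!: functor_eqI is_functor_comp_functor is_functor_id_functor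
        F.source.category_axioms F.target.category_axioms)
  ultimately show ?thesis unfolding is_isomorphism_def using F
    by (intro conjI exI[of _ "mk_functor ?B ?A G0 G1"]) auto
qed


section \<open>Simplicial categories and Segal maps\<close>

declare One_nat_def [simp del] plus_1_eq_Suc [simp]

interpretation Delta: category Delta by (rule category_Delta)

section \<open>Edges and vertices in the simplex category\<close>

definition coface :: "nat \<Rightarrow> darr" where
  "coface i = (0, \<lambda>_ \<in> {..0}. 1 - i, 1)"

lemma face_eq: "face X i = FAr X (coface i)"
  by (simp add: face_def coface_def)

lemma coface_hom: "coface i \<in> hom Delta 0 1"
  by (auto simp: coface_def hom_Delta mono_on_def)

text \<open>\<open>edge\<close> counts from 1 and contains \<open>j - 1\<close>. Shifting the index
  removes the truncated subtraction and matches list positions, which count from 0.\<close>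

lemma edge_Suc: "edge k (Suc j) = (1, \<lambda>i \<in> {..1}. if i = 0 then j else Suc j, k)"
  by (auto simp: edge_def restrict_def fun_eq_iff)

lemma edge_hom: "j < k \<Longrightarrow> edge k (Suc j) \<in> hom Delta 1 k"
  by (auto simp: edge_Suc hom_Delta mono_on_def)

text \<open>Both sides are the vertex \<open>Suc j\<close> of \<open>[k]\<close>, the end of one
  edge and the start of the next. This is what places the values of the Segal map in the iterated
  pullback.\<close>

lemma edge_coface:
  assumes "Suc j < k"
  shows "Cmp Delta (edge k (Suc j)) (coface 0) = Cmp Delta (edge k (Suc (Suc j))) (coface 1)"
  using edge_hom[of j k] edge_hom[of "Suc j" k] coface_hom[of 0] coface_hom[of 1] assms
  by (auto simp: edge_Suc coface_def hom_def Delta_simps compose_def fun_eq_iff)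

text \<open>For positive \<open>k\<close> every vertex of \<open>[k]\<close> lies on an edge, so the
  edges determine all values. The codomains may differ a priori, and one edge shows that they agree.
  This is the uniqueness half of the strict Segal condition for a disjoint union of standard
  simplices.\<close>

lemma Delta_eq_if_edges_eq:
  assumes "0 < k" "f \<in> hom Delta k m" "g \<in> hom Delta k n"
    and eq: "\<And>j. j < k \<Longrightarrow> Cmp Delta f (edge k (Suc j)) = Cmp Delta g (edge k (Suc j))"
  shows "f = g"
proof -
  obtain f' where f: "f = (k, f', m)" "f \<in> Arr Delta" "f' \<in> extensional {..k}"
    using assms(2) by (auto simp: hom_Delta Delta_simps(1) PiE_def)
  obtain g' where g: "g = (k, g', n)" "g \<in> Arr Delta" "g' \<in> extensional {..k}"
    using assms(3) by (auto simp: hom_Delta Delta_simps(1) PiE_def)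
  have e: "m = n \<and> f' j = g' j \<and> f' (Suc j) = g' (Suc j)" if "j < k" for j
  proof -
    have "edge k (Suc j) \<in> Arr Delta" using edge_hom[OF that] by (simp add: hom_def)
    then have "m = n" "compose {..1} f' (\<lambda>i\<in>{..1::nat}. if i = 0 then j else Suc j) =
        compose {..1} g' (\<lambda>i\<in>{..1::nat}. if i = 0 then j else Suc j)"
      using eq[OF that] f g by (auto simp: edge_Suc Delta_simps(4))
    from this(1) fun_cong[OF this(2), of 0] fun_cong[OF this(2), of 1]
    show ?thesis by (simp add: compose_def)
  qed
  \<comment> \<open>Vertex 0 is the start of the first edge, and vertex \<open>Suc i\<close> is the
    end of the edge that starts at \<open>i\<close>.\<close>
  have "f' i = g' i" if "i \<in> {..k}" for i
    using e[of i] e[of "i - 1"] that assms(1) by (cases i) auto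
  then have "f' = g'" using f(3) g(3) by (rule extensionalityI[rotated 2])
  then show ?thesis using f g e[OF assms(1)] by simp
qed

text \<open>The existence half: the standard \<open>m\<close>-simplex is the nerve of a total order,
  so the successive inequalities along a chain of edges combine into one monotone map.\<close>

lemma Delta_glue_edges:
  assumes "0 < k" "\<And>j. j < k \<Longrightarrow> f j \<in> hom Delta 1 m"
    and match: "\<And>j. Suc j < k \<Longrightarrow> Cmp Delta (f j) (coface 0) = Cmp Delta (f (Suc j)) (coface 1)"
  obtains g where "g \<in> hom Delta k m" "\<And>j. j < k \<Longrightarrow> Cmp Delta g (edge k (Suc j)) = f j"
proof -
  define h where "h j = fst (snd (f j))" for j
  have f: "f j = (1, h j, m)" "f j \<in> Arr Delta" "h j \<in> extensional {..1}" "h j 0 \<le> h j 1" "h j 1 \<le> m"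
    if "j < k" for j
    using assms(2)[OF that] by (auto simp: hom_Delta h_def Delta_simps(1) mono_on_def PiE_def Pi_def)
  have hh: "h j 1 = h (Suc j) 0" if "Suc j < k" for j
  proof -
    have "compose {..0::nat} (h j) (\<lambda>_ \<in> {..0}. 1) = compose {..0::nat} (h (Suc j)) (\<lambda>_ \<in> {..0}. 0)"
      using match[OF that] f[of j] f[of "Suc j"] coface_hom[of 0] coface_hom[of 1] that
      by (simp add: coface_def Delta_simps(4) hom_def)
    from fun_cong[OF this, of 0] show ?thesis by (simp add: compose_def)
  qed
  \<comment> \<open>Vertex 0 is the start of the first edge and each later vertex is the end of the
    edge before it. By \<open>hh\<close> the value at \<open>j\<close> is also the start of edge
    \<open>j\<close>.\<close>
  define g' where "g' = (\<lambda>i \<in> {..k}. if i = 0 then h 0 0 else h (i - 1) 1)"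
  have g'0: "g' j = h j 0" and g'1: "g' (Suc j) = h j 1" if "j < k" for j
    using hh[of "j - 1"] that by (cases j; simp add: g'_def)+
  have "g' i \<le> g' j" if "i \<le> j" "j \<le> k" for i j
    using that
  proof (induction j rule: dec_induct)
    case (step j)
    have "g' j \<le> g' (Suc j)" using g'0[of j] g'1[of j] f(4)[of j] step by simp
    then show ?case using step by simp
  qed simp
  moreover have "g' i \<le> m" if "i \<le> k" for i
    using f(5)[of "i - 1"] f(4,5)[of 0] that assms(1) by (auto simp: g'_def intro: order_trans)
  ultimately have g: "(k, g', m) \<in> hom Delta k m"
    by (auto simp: hom_Delta mono_on_def g'_def)
  show thesis
  proof (rule that[OF g])
    fix j assume j: "j < k"
    have "compose {..1} g' (\<lambda>i\<in>{..1}. if i = 0 then j else Suc j) = h j"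
      using g'0[OF j] g'1[OF j] f(3)[OF j]
      by (intro extensionalityI[of _ "{..1}"]) (auto simp: compose_def le_Suc_eq One_nat_def)
    then show "Cmp Delta (k, g', m) (edge k (Suc j)) = f j"
      using g edge_hom[OF j] f[OF j] by (simp add: edge_Suc hom_def Delta_simps(4))
  qed
qed

locale simplicial = is_functor X for X :: "'u simp_cat" +
  assumes Src_X: "Src X = Delta_op" and Tgt_X: "Tgt X = Cat"
begin

lemma level: "category (FOb X k)"
  using ob[of k] by (simp add: Src_X Tgt_X)

lemma action:
  assumes "f \<in> hom Delta k m"
  shows "is_functor (FAr X f)" "Src (FAr X f) = FOb X m" "Tgt (FAr X f) = FOb X k"
  using ar_hom[of f m k] assms by (auto simp: Src_X Tgt_X)

lemma action_id: "FAr X (Id Delta k) = id_functor (FOb X k)"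
  using pres_id[of k] level by (simp add: Src_X Tgt_X)

lemma action_cmp:
  "f \<in> hom Delta m n \<Longrightarrow> g \<in> hom Delta k m \<Longrightarrow> FAr X (Cmp Delta f g) = FAr X g \<circ>\<^sub>F FAr X f"
  using ar_cmp[of g m k f n] action[of f m n] action[of g k m] by (simp add: Src_X Tgt_X)

lemma action_ob: "f \<in> hom Delta k m \<Longrightarrow> x \<in> Obj (FOb X m) \<Longrightarrow> FOb (FAr X f) x \<in> Obj (FOb X k)"
  using is_functor.ob[OF action(1), of f k m x] action(2,3)[of f k m] by simp

lemma action_hom: "f \<in> hom Delta k m \<Longrightarrow> u \<in> hom (FOb X m) x y \<Longrightarrow>
    FAr (FAr X f) u \<in> hom (FOb X k) (FOb (FAr X f) x) (FOb (FAr X f) y)"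
  using is_functor.ar_hom[OF action(1), of f k m u x y] action(2,3)[of f k m] by simp

lemma action_cmp_ob: "f \<in> hom Delta m n \<Longrightarrow> g \<in> hom Delta k m \<Longrightarrow> x \<in> Obj (FOb X n) \<Longrightarrow>
    FOb (FAr X (Cmp Delta f g)) x = FOb (FAr X g) (FOb (FAr X f) x)"
  using action(2)[of f m n] by (simp add: action_cmp)

lemma action_cmp_ar: "f \<in> hom Delta m n \<Longrightarrow> g \<in> hom Delta k m \<Longrightarrow> u \<in> Arr (FOb X n) \<Longrightarrow>
    FAr (FAr X (Cmp Delta f g)) u = FAr (FAr X g) (FAr (FAr X f) u)"
  using action(2)[of f m n] by (simp add: action_cmp)

lemma action_pres_id: "f \<in> hom Delta k m \<Longrightarrow> x \<in> Obj (FOb X m) \<Longrightarrow>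
    FAr (FAr X f) (Id (FOb X m) x) = Id (FOb X k) (FOb (FAr X f) x)"
  using is_functor.pres_id[OF action(1), of f k m x] action(2,3)[of f k m] by simp

lemma action_pres_cmp: "f \<in> hom Delta k m \<Longrightarrow> v \<in> hom (FOb X m) y z \<Longrightarrow> u \<in> hom (FOb X m) x y \<Longrightarrow>
    FAr (FAr X f) (Cmp (FOb X m) v u) = Cmp (FOb X k) (FAr (FAr X f) v) (FAr (FAr X f) u)"
  using is_functor.ar_cmp[OF action(1), of f k m v y z u x] action(2,3)[of f k m] by simp

end

lemma simplicial_mk_functor:
  assumes "\<And>k. category (C k)"
    and "\<And>f k m. f \<in> hom Delta k m \<Longrightarrow> is_functor (F f) \<and> Src (F f) = C m \<and> Tgt (F f) = C k"
    and "\<And>k. F (Id Delta k) = id_functor (C k)"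
    and "\<And>f g k m n. f \<in> hom Delta m n \<Longrightarrow> g \<in> hom Delta k m \<Longrightarrow> F (Cmp Delta f g) = F g \<circ>\<^sub>F F f"
  shows "simplicial (mk_functor Delta_op Cat C F)"
proof (intro simplicial.intro simplicial_axioms.intro is_functor_mk_functor)
  fix g f and x y z :: nat
  assume gf: "g \<in> hom Delta_op y z" "f \<in> hom Delta_op x y"
  then show "F (Cmp Delta_op g f) = Cmp Cat (F g) (F f)"
    using assms(2)[of g z y] assms(2)[of f y x] assms(4)[of f y x g z] by simp
qed (use assms category_Cat category_Delta_op in auto)

lemma Obj_SimpCat: "X \<in> Obj SimpCat \<longleftrightarrow> simplicial X"
  by (auto simp: SimpCat_def functor_category_def simplicial_def simplicial_axioms_def)

section \<open>Iterated pullbacks, entry by entry\<close>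

lemma Obj_iterated_pullback:
  "xs \<in> Obj (iterated_pullback k s t) \<longleftrightarrow> length xs = k \<and> (\<forall>j<k. xs ! j \<in> Obj (Src s)) \<and>
     (\<forall>j. Suc j < k \<longrightarrow> FOb t (xs ! j) = FOb s (xs ! Suc j))"
  by (auto simp: iterated_pullback_def subset_iff in_set_conv_nth)

lemma Arr_iterated_pullback:
  "fs \<in> Arr (iterated_pullback k s t) \<longleftrightarrow> length fs = k \<and> (\<forall>j<k. fs ! j \<in> Arr (Src s)) \<and>
     (\<forall>j. Suc j < k \<longrightarrow> FAr t (fs ! j) = FAr s (fs ! Suc j))"
  by (auto simp: iterated_pullback_def subset_iff in_set_conv_nth)

lemma hom_iterated_pullback:
  "fs \<in> hom (iterated_pullback k s t) xs ys \<longleftrightarrow> length fs = k \<and> length xs = k \<and> length ys = k \<and>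
     (\<forall>j<k. fs ! j \<in> hom (Src s) (xs ! j) (ys ! j)) \<and>
     (\<forall>j. Suc j < k \<longrightarrow> FAr t (fs ! j) = FAr s (fs ! Suc j))"
  unfolding iterated_pullback_def hom_mk_category
  by (auto simp: subset_iff in_set_conv_nth hom_def list_eq_iff_nth_eq)

lemma Id_iterated_pullback:
  "xs \<in> Obj (iterated_pullback k s t) \<Longrightarrow> Id (iterated_pullback k s t) xs = map (Id (Src s)) xs"
  by (simp add: iterated_pullback_def)

lemma Cmp_iterated_pullback:
  "gs \<in> hom (iterated_pullback k s t) ys zs \<Longrightarrow> fs \<in> hom (iterated_pullback k s t) xs ys \<Longrightarrow>
    Cmp (iterated_pullback k s t) gs fs = map2 (Cmp (Src s)) gs fs"
  by (simp add: iterated_pullback_def)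

text \<open>All operations act entrywise; that the matching conditions survive them is the
  functoriality of \<open>s\<close> and \<open>t\<close>.\<close>

lemma category_iterated_pullback:
  assumes "is_functor s" "is_functor t" "Src t = Src s" "Tgt t = Tgt s"
  shows "category (iterated_pullback k s t)"
proof -
  interpret s: is_functor s by fact
  interpret t: is_functor t by fact
  let ?A = "Src s"
  have comp: "composable ?A (gs ! j) (fs ! j)"
    if "set gs \<subseteq> Arr ?A" "set fs \<subseteq> Arr ?A" "length gs = k" "length fs = k"
      "map (Dom ?A) gs = map (Cod ?A) fs" "j < k" for gs fs j
  proof -
    have "gs ! j \<in> set gs" "fs ! j \<in> set fs" using that by auto
    moreover have "Dom ?A (gs ! j) = Cod ?A (fs ! j)"
      using arg_cong[OF that(5), of "\<lambda>l. l ! j"] that(3,4,6) by simp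
    ultimately show ?thesis using that by (auto simp: composable_def)
  qed
  have arr: "fs ! j \<in> Arr ?A" if "set fs \<subseteq> Arr ?A" "length fs = k" "j < k" for fs j
    using that nth_mem by blast
  have obj: "xs ! j \<in> Obj ?A" if "set xs \<subseteq> Obj ?A" "length xs = k" "j < k" for xs j
    using that nth_mem by blast
  note tc = t.pres_cmp[unfolded assms(3,4)] and ti = t.pres_id[unfolded assms(3,4)]
    and ta = t.ar_Arr[unfolded assms(3,4)]
  show ?thesis unfolding iterated_pullback_def
  proof (rule category_mk_category, goal_cases)
    case (1 f)
    have "FOb t (Dom ?A (f ! j)) = FOb s (Dom ?A (f ! Suc j))" if "Suc j < k" for j
      using 1 that ta(2)[of "f ! j"] s.ar_Arr(2)[of "f ! Suc j"] arr[of f] by auto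
    with 1 show ?case using s.source.dom_obj by auto
  next
    case (2 f)
    have "FOb t (Cod ?A (f ! j)) = FOb s (Cod ?A (f ! Suc j))" if "Suc j < k" for j
      using 2 that ta(3)[of "f ! j"] s.ar_Arr(3)[of "f ! Suc j"] arr[of f] by auto
    with 2 show ?case using s.source.cod_obj by auto
  next
    case (3 x)
    then have len: "length x = k" and x: "\<And>j. j < k \<Longrightarrow> x ! j \<in> Obj ?A"
      and m: "\<And>j. Suc j < k \<Longrightarrow> FOb t (x ! j) = FOb s (x ! Suc j)"
      using obj by auto
    have "Id ?A (x ! j) \<in> hom ?A (x ! j) (x ! j)" if "j < k" for j
      using x[OF that] by (rule s.source.id_hom)
    then have i: "Id ?A (x ! j) \<in> Arr ?A" "Dom ?A (Id ?A (x ! j)) = x ! j" "Cod ?A (Id ?A (x ! j)) = x ! j"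
      if "j < k" for j using that by (auto simp: hom_def)
    have "FAr t (Id ?A (x ! j)) = FAr s (Id ?A (x ! Suc j))" if "Suc j < k" for j
      using ti x m s.pres_id that by simp
    then show ?case using i len by (auto simp: in_set_conv_nth intro!: nth_equalityI)
  next
    case (4 g f)
    then have len: "length g = k" "length f = k" by auto
    have c: "composable ?A (g ! j) (f ! j)" if "j < k" for j using 4 that by (intro comp) auto
    have h: "Cmp ?A (g ! j) (f ! j) \<in> Arr ?A"
      "Dom ?A (Cmp ?A (g ! j) (f ! j)) = Dom ?A (f ! j)"
      "Cod ?A (Cmp ?A (g ! j) (f ! j)) = Cod ?A (g ! j)" if "j < k" for j
      using s.source.cmp_hom[OF c[OF that]] by (auto simp: hom_def)
    have "FAr t (Cmp ?A (g ! j) (f ! j)) = FAr s (Cmp ?A (g ! Suc j) (f ! Suc j))" if "Suc j < k" for j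
      using tc[OF c, of j] s.pres_cmp[OF c, of "Suc j"] 4 that by simp
    then show ?case using h len by (auto simp: in_set_conv_nth intro!: nth_equalityI)
  next
    case (5 f)
    then show ?case by (auto intro!: nth_equalityI s.source.id_left arr)
  next
    case (6 f)
    then show ?case by (auto intro!: nth_equalityI s.source.id_right arr)
  next
    case (7 h g f)
    then have len: "length h = k" "length g = k" "length f = k" by auto
    have "composable ?A (g ! j) (f ! j)" "composable ?A (h ! j) (g ! j)" if "j < k" for j
      using 7 that by (auto intro!: comp)
    then show ?case using len by (auto intro!: nth_equalityI s.source.assoc)
  qed
qed

context simplicial
begin

lemma face:
  "is_functor (face X i)" "Src (face X i) = FOb X 1" "Tgt (face X i) = FOb X 0"
  unfolding face_eq using action[OF coface_hom] by auto

lemma category_segal_target: "category (iterated_pullback k (face X 1) (face X 0))"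
  by (rule category_iterated_pullback) (simp_all add: face)

lemma segal_map_nth:
  "x \<in> Obj (FOb X k) \<Longrightarrow> j < k \<Longrightarrow> FOb (segal_map X k) x ! j = FOb (FAr X (edge k (Suc j))) x"
  "u \<in> Arr (FOb X k) \<Longrightarrow> j < k \<Longrightarrow> FAr (segal_map X k) u ! j = FAr (FAr X (edge k (Suc j))) u"
  by (simp_all add: segal_map_def nth_append del: upt_Suc)

lemma length_segal_map:
  "x \<in> Obj (FOb X k) \<Longrightarrow> length (FOb (segal_map X k) x) = k"
  "u \<in> Arr (FOb X k) \<Longrightarrow> length (FAr (segal_map X k) u) = k"
  by (simp_all add: segal_map_def del: upt_Suc)

lemma segal_map_Src_Tgt: "Src (segal_map X k) = FOb X k"
  "Tgt (segal_map X k) = iterated_pullback k (face X 1) (face X 0)"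
  by (simp_all add: segal_map_def)

text \<open>The matching conditions are \<open>edge_coface\<close> transported along
  \<open>X\<close>. Identities and composites are preserved entrywise, since each edge acts by a
  functor.\<close>

lemma is_functor_segal_map: "is_functor (segal_map X k)"
proof -
  interpret C: category "FOb X k" by (rule level)
  have nth: "map h [1..<Suc k] ! j = h (Suc j)" if "j < k" for h :: "nat \<Rightarrow> 'x" and j
    using that by (simp del: upt_Suc)
  have obj: "map (\<lambda>j. FOb (FAr X (edge k j)) x) [1..<Suc k] \<in> Obj (iterated_pullback k (face X 1) (face X 0))"
    if x: "x \<in> Obj (FOb X k)" for x
    using x by (auto simp: edge_coface Obj_iterated_pullback nth face face_eq
        action(2)[OF coface_hom]
        action_ob[OF edge_hom] action_cmp_ob[OF edge_hom coface_hom, symmetric] simp del: upt_Suc)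
  have hom: "map (\<lambda>j. FAr (FAr X (edge k j)) u) [1..<Suc k] \<in> hom (iterated_pullback k (face X 1) (face X 0))
     (map (\<lambda>j. FOb (FAr X (edge k j)) x) [1..<Suc k]) (map (\<lambda>j. FOb (FAr X (edge k j)) y) [1..<Suc k])"
    if u: "u \<in> hom (FOb X k) x y" for u x y
  proof -
    have "u \<in> Arr (FOb X k)" using u by (simp add: hom_def)
    then show ?thesis using u
      by (auto simp: edge_coface hom_iterated_pullback nth face face_eq
        action(2)[OF coface_hom]
          action_hom[OF edge_hom] action_cmp_ar[OF edge_hom coface_hom, symmetric] simp del: upt_Suc)
  qed
  show ?thesis unfolding segal_map_def
  proof (rule is_functor_mk_functor)
    fix x assume x: "x \<in> Obj (FOb X k)"
    then show "map (\<lambda>j. FAr (FAr X (edge k j)) (Id (FOb X k) x)) [1..<Suc k] =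
      Id (iterated_pullback k (face X 1) (face X 0)) (map (\<lambda>j. FOb (FAr X (edge k j)) x) [1..<Suc k])"
      by (simp add: Id_iterated_pullback[OF obj] list_eq_iff_nth_eq face action_pres_id[OF edge_hom] del: upt_Suc)
  next
    fix g f x y z assume gf: "g \<in> hom (FOb X k) y z" "f \<in> hom (FOb X k) x y"
    then show "map (\<lambda>j. FAr (FAr X (edge k j)) (Cmp (FOb X k) g f)) [1..<Suc k] =
      Cmp (iterated_pullback k (face X 1) (face X 0)) (map (\<lambda>j. FAr (FAr X (edge k j)) g) [1..<Suc k])
        (map (\<lambda>j. FAr (FAr X (edge k j)) f) [1..<Suc k])"
      by (simp add: Cmp_iterated_pullback[OF hom hom] list_eq_iff_nth_eq face action_pres_cmp[OF edge_hom] del: upt_Suc)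
  qed (simp_all add: level category_segal_target obj hom del: upt_Suc)
qed

end


section \<open>The resolution\<close>

text \<open>
  Level \<open>k\<close> of the resolution has the pairs \<open>(f : [k] \<rightarrow> [m], x \<in> X\<^sub>m)\<close> as objects and the triples
  (domain, codomain, arrow of \<open>X\<^sub>k\<close>) as arrows.  The locale packs both into the universe \<open>'u\<close>.
\<close>

locale coding =
  fixes node :: "darr \<Rightarrow> 'u \<Rightarrow> 'u" and shape :: "'u \<Rightarrow> darr" and point :: "'u \<Rightarrow> 'u"
    and arrow :: "'u \<Rightarrow> 'u \<Rightarrow> 'u \<Rightarrow> 'u" and tail head label :: "'u \<Rightarrow> 'u"
  assumes shape_Arr: "shape a \<in> Arr Delta"
    and shape_node [simp]: "f \<in> Arr Delta \<Longrightarrow> shape (node f x) = f"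
    and point_node [simp]: "f \<in> Arr Delta \<Longrightarrow> point (node f x) = x"
    and node_eta [simp]: "node (shape a) (point a) = a"
    and tail_arrow [simp]: "tail (arrow a b u) = a"
    and head_arrow [simp]: "head (arrow a b u) = b"
    and label_arrow [simp]: "label (arrow a b u) = u"
    and arrow_eta [simp]: "arrow (tail w) (head w) (label w) = w"

section \<open>Packing pairs and triples into an infinite universe\<close>

text \<open>A monotone map is coded by its ends and the list of its values. The code is injective
  because the maps are \<open>undefined\<close> off their domain, so the listed values determine
  them.\<close>

lemma countable_Arr_Delta: "countable (Arr Delta)"
proof (rule countableI')
  show "inj_on (\<lambda>(m, f, n). to_nat (m, map f [0..<Suc m], n)) (Arr Delta)"
  proof (rule inj_onI)
    fix p q :: darr
    assume pq: "p \<in> Arr Delta" "q \<in> Arr Delta"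
      and code: "(\<lambda>(m, f, n). to_nat (m, map f [0..<Suc m], n)) p
        = (\<lambda>(m, f, n). to_nat (m, map f [0..<Suc m], n)) q"
    obtain m f n m' f' n' where p: "p = (m, f, n)" and q: "q = (m', f', n')"
      by (metis prod_cases3)
    have eq: "m = m'" "n = n'" "map f [0..<Suc m] = map f' [0..<Suc m]"
      using code by (auto simp: p q)
    have "f i = f' i" if "i \<in> {..m}" for i
    proof -
      have "i \<in> set [0..<Suc m]" using that by auto
      then show ?thesis using eq(3) unfolding map_eq_conv by blast
    qed
    then have "f = f'" using pq eq(1)
      by (intro extensionalityI[of f "{..m}"]) (auto simp: p q Delta_simps(1) PiE_def)
    then show "p = q" using eq by (simp add: p q)
  qed
qed

text \<open>Infinity of the universe enters here. \<open>Arr Delta\<close> is countable and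
  nonempty, so its product with \<open>'u\<close> is in bijection with \<open>'u\<close>, which
  codes nodes. A bijection between pairs over \<open>'u\<close> and \<open>'u\<close>, applied
  twice, codes the triples.\<close>

lemma ex_coding:
  includes cardinal_syntax
  assumes inf: "infinite (UNIV :: 'u set)"
  shows "\<exists>(node :: darr \<Rightarrow> 'u \<Rightarrow> 'u) shape point arrow tail head label.
    coding node shape point arrow tail head label"
proof -
  have le: "|Arr Delta| \<le>o |UNIV :: 'u set|"
  proof -
    have "|Arr Delta| \<le>o |UNIV :: nat set|"
      using countable_Arr_Delta by (auto simp: countable_def card_of_ordLeq[symmetric])
    also have "|UNIV :: nat set| \<le>o |UNIV :: 'u set|"
      using inf by (simp add: infinite_iff_card_of_nat)
    finally (ordLeq_transitive) show ?thesis .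
  qed
  have "Id Delta 0 \<in> Arr Delta" using Delta.id_hom[of 0] by (simp add: hom_def)
  then have "|Arr Delta \<times> (UNIV :: 'u set)| =o |UNIV :: 'u set|"
    using card_of_Times_infinite[OF inf _ le] by auto
  then obtain p where p: "bij_betw p (Arr Delta \<times> (UNIV :: 'u set)) (UNIV :: 'u set)"
    using card_of_ordIso by blast
  have "|UNIV \<times> UNIV :: ('u \<times> 'u) set| =o |UNIV :: 'u set|"
    using inf by (rule card_of_Times_same_infinite)
  then obtain q where q: "bij_betw q (UNIV :: ('u \<times> 'u) set) (UNIV :: 'u set)"
    using card_of_ordIso by (metis UNIV_Times_UNIV)
  define p' where "p' = inv_into (Arr Delta \<times> (UNIV :: 'u set)) p"
  have p': "p' a \<in> Arr Delta \<times> UNIV" "p (p' a) = a" "z \<in> Arr Delta \<times> UNIV \<Longrightarrow> p' (p z) = z" for a z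
    using bij_betwE[OF bij_betw_inv_into[OF p]] bij_betw_inv_into_right[OF p] bij_betw_inv_into_left[OF p]
    unfolding p'_def by blast+
  have q': "q (inv q a) = a" "inv q (q z) = z" for a z
    using q by (auto simp: bij_betw_def surj_f_inv_f)
  have "coding (\<lambda>f x. p (f, x)) (fst \<circ> p') (snd \<circ> p') (\<lambda>a b u. q (q (a, b), u))
    (fst \<circ> inv q \<circ> fst \<circ> inv q) (snd \<circ> inv q \<circ> fst \<circ> inv q) (snd \<circ> inv q)"
    using p' by unfold_locales (auto simp: q' mem_Times_iff)
  then show ?thesis by blast
qed

context coding
begin

definition ev :: "'u simp_cat \<Rightarrow> 'u \<Rightarrow> 'u" where
  "ev X a = FOb (FAr X (shape a)) (point a)"

definition nodes :: "'u simp_cat \<Rightarrow> nat \<Rightarrow> 'u set" where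
  "nodes X k = {a. Dom Delta (shape a) = k \<and> point a \<in> Obj (FOb X (Cod Delta (shape a)))}"

text \<open>Arrows carry their ends explicitly: distinct nodes may have the same evaluation, so the
  label in \<open>X\<close> does not determine them.\<close>

definition res_level :: "'u simp_cat \<Rightarrow> nat \<Rightarrow> 'u scat" where
  "res_level X k = mk_category (nodes X k)
     {w. tail w \<in> nodes X k \<and> head w \<in> nodes X k \<and>
         label w \<in> hom (FOb X k) (ev X (tail w)) (ev X (head w))}
     tail head
     (\<lambda>a. arrow a a (Id (FOb X k) (ev X a)))
     (\<lambda>w v. arrow (tail v) (head w) (Cmp (FOb X k) (label w) (label v)))"

definition pull :: "darr \<Rightarrow> 'u \<Rightarrow> 'u" where
  "pull g a = node (Cmp Delta (shape a) g) (point a)"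

definition map_arrow :: "('u \<Rightarrow> 'u) \<Rightarrow> ('u \<Rightarrow> 'u) \<Rightarrow> 'u \<Rightarrow> 'u" where
  "map_arrow F0 F1 w = arrow (F0 (tail w)) (F0 (head w)) (F1 (label w))"

definition res_action :: "'u simp_cat \<Rightarrow> darr \<Rightarrow> 'u sfun" where
  "res_action X g = mk_functor (res_level X (Cod Delta g)) (res_level X (Dom Delta g))
     (pull g) (map_arrow (pull g) (FAr (FAr X g)))"

definition res :: "'u simp_cat \<Rightarrow> 'u simp_cat" where
  "res X = mk_functor Delta_op Cat (res_level X) (res_action X)"

lemma shape_hom: "a \<in> nodes X k \<Longrightarrow> shape a \<in> hom Delta k (Cod Delta (shape a))"
  using shape_Arr by (auto simp: nodes_def hom_def)

lemma arrow_eqI: "tail v = tail w \<Longrightarrow> head v = head w \<Longrightarrow> label v = label w \<Longrightarrow> v = w"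
  using arrow_eta[of v] arrow_eta[of w] by metis

lemma node_eqI: "shape a = shape b \<Longrightarrow> point a = point b \<Longrightarrow> a = b"
  using node_eta[of a] node_eta[of b] by metis

lemma pull_shape_point:
  assumes "a \<in> nodes X k" "g \<in> hom Delta l k"
  shows "shape (pull g a) = Cmp Delta (shape a) g" "point (pull g a) = point a"
  using Delta.cmp_in_hom[OF shape_hom[OF assms(1)] assms(2)] by (auto simp: pull_def hom_def)

lemma pull_nodes: "a \<in> nodes X k \<Longrightarrow> g \<in> hom Delta l k \<Longrightarrow> pull g a \<in> nodes X l"
  using pull_shape_point[of a X k g l] Delta.cmp_in_hom[OF shape_hom[of a X k], of g l]
  by (auto simp: nodes_def hom_def)

lemma pull_id: "a \<in> nodes X k \<Longrightarrow> pull (Id Delta k) a = a"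
  using Delta.cmp_id_right[OF shape_hom[of a X k]] by (simp add: pull_def)

text \<open>Restriction precomposes the shape and leaves the point alone, so associativity in
  \<open>Delta\<close> gives an equality of nodes, not just an isomorphism.\<close>

lemma pull_cmp:
  assumes "a \<in> nodes X n" "f \<in> hom Delta m n" "g \<in> hom Delta k m"
  shows "pull (Cmp Delta f g) a = pull g (pull f a)"
  using pull_shape_point[OF assms(1,2)] Delta.cmp_assoc[OF shape_hom[OF assms(1)] assms(2,3)]
  by (simp add: pull_def)

lemma Obj_res_level [simp]: "Obj (res_level X k) = nodes X k"
  by (simp add: res_level_def)

lemma hom_res_level: "w \<in> hom (res_level X k) a b \<longleftrightarrow> tail w = a \<and> head w = b \<and>
    a \<in> nodes X k \<and> b \<in> nodes X k \<and> label w \<in> hom (FOb X k) (ev X a) (ev X b)"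
  by (auto simp: res_level_def)

lemma Arr_res_level: "w \<in> Arr (res_level X k) \<longleftrightarrow> w \<in> hom (res_level X k) (tail w) (head w)"
  by (auto simp: res_level_def)

lemma Id_res_level: "a \<in> nodes X k \<Longrightarrow> Id (res_level X k) a = arrow a a (Id (FOb X k) (ev X a))"
  by (simp add: res_level_def)

lemma Cmp_res_level: "w \<in> hom (res_level X k) b c \<Longrightarrow> v \<in> hom (res_level X k) a b \<Longrightarrow>
    Cmp (res_level X k) w v = arrow a c (Cmp (FOb X k) (label w) (label v))"
  by (auto simp: res_level_def)

lemma res_simps [simp]: "FOb (res X) k = res_level X k" "Src (res X) = Delta_op" "Tgt (res X) = Cat"
  by (simp_all add: res_def)

lemma res_action_eq: "g \<in> hom Delta k m \<Longrightarrow> res_action X g =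
    mk_functor (res_level X m) (res_level X k) (pull g) (map_arrow (pull g) (FAr (FAr X g)))"
  by (auto simp: res_action_def hom_def)

lemma FAr_res: "g \<in> hom Delta k m \<Longrightarrow> FAr (res X) g = res_action X g"
  by (auto simp: res_def hom_def)

lemma map_arrow_simps [simp]:
  "tail (map_arrow F0 F1 w) = F0 (tail w)" "head (map_arrow F0 F1 w) = F0 (head w)"
  "label (map_arrow F0 F1 w) = F1 (label w)"
  by (simp_all add: map_arrow_def)

end

locale resolution = coding node shape point arrow tail head label + simplicial X
  for node :: "darr \<Rightarrow> 'u \<Rightarrow> 'u" and shape point arrow tail head label and X :: "'u simp_cat"
begin

lemma ev_obj: "a \<in> nodes X k \<Longrightarrow> ev X a \<in> Obj (FOb X k)"
  using action_ob[OF shape_hom[of a X k], of "point a"] by (simp add: ev_def nodes_def)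

text \<open>This is functoriality of \<open>X\<close> at a composite. It gives strict naturality of
  evaluation on objects and puts restricted labels between the right ends.\<close>

lemma ev_pull:
  assumes "a \<in> nodes X k" "g \<in> hom Delta l k"
  shows "ev X (pull g a) = FOb (FAr X g) (ev X a)"
  using action_cmp_ob[OF shape_hom[OF assms(1)] assms(2)] assms(1) pull_shape_point[OF assms]
  by (simp add: ev_def nodes_def)

lemma category_res_level: "category (res_level X k)"
  unfolding res_level_def
proof -
  interpret C: category "FOb X k" by (rule level)
  show "category (mk_category (nodes X k)
     {w. tail w \<in> nodes X k \<and> head w \<in> nodes X k \<and>
         label w \<in> hom (FOb X k) (ev X (tail w)) (ev X (head w))}
     tail head
     (\<lambda>a. arrow a a (Id (FOb X k) (ev X a)))
     (\<lambda>w v. arrow (tail v) (head w) (Cmp (FOb X k) (label w) (label v))))"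
  proof (rule category_mk_category, goal_cases)
    case (7 h g f)
    then have "Cmp (FOb X k) (Cmp (FOb X k) (label h) (label g)) (label f)
        = Cmp (FOb X k) (label h) (Cmp (FOb X k) (label g) (label f))"
      by (intro C.cmp_assoc[where w = "ev X (tail f)" and x = "ev X (tail g)" and y = "ev X (tail h)"
            and z = "ev X (head h)"]) auto
    then show ?case by simp
  qed (auto simp: C.cmp_id_left C.cmp_id_right C.id_hom ev_obj intro!: C.cmp_in_hom)
qed

lemma map_arrow_hom:
  "g \<in> hom Delta k m \<Longrightarrow> w \<in> hom (res_level X m) a b \<Longrightarrow>
    map_arrow (pull g) (FAr (FAr X g)) w \<in> hom (res_level X k) (pull g a) (pull g b)"
  by (auto simp: hom_res_level pull_nodes ev_pull intro!: action_hom)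

lemma is_functor_res_action:
  assumes g: "g \<in> hom Delta k m"
  shows "is_functor (res_action X g)"
  unfolding res_action_eq[OF g]
proof (rule is_functor_mk_functor)
  fix a assume a: "a \<in> Obj (res_level X m)"
  then show "map_arrow (pull g) (FAr (FAr X g)) (Id (res_level X m) a) = Id (res_level X k) (pull g a)"
    using g by (simp add: Id_res_level map_arrow_def pull_nodes[of a X m g k] action_pres_id[OF g] ev_obj
        ev_pull[of a m g k])
next
  fix w v a b c assume w: "w \<in> hom (res_level X m) b c" and v: "v \<in> hom (res_level X m) a b"
  then show "map_arrow (pull g) (FAr (FAr X g)) (Cmp (res_level X m) w v) =
      Cmp (res_level X k) (map_arrow (pull g) (FAr (FAr X g)) w) (map_arrow (pull g) (FAr (FAr X g)) v)"
    unfolding Cmp_res_level[OF w v] Cmp_res_level[OF map_arrow_hom[OF g w] map_arrow_hom[OF g v]]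
    using action_pres_cmp[OF g, of "label w" _ _ "label v"]
    by (auto simp: map_arrow_def hom_res_level)
qed (use g in \<open>auto simp: category_res_level pull_nodes map_arrow_hom\<close>)

lemma Arr_res_levelD:
  assumes "w \<in> Arr (res_level X k)"
  shows "tail w \<in> nodes X k" "head w \<in> nodes X k"
    "label w \<in> hom (FOb X k) (ev X (tail w)) (ev X (head w))"
  using assms by (auto simp: Arr_res_level hom_res_level)

lemma label_Arr: "w \<in> Arr (res_level X k) \<Longrightarrow> label w \<in> Arr (FOb X k)"
  using Arr_res_levelD(3)[of w k] by (simp add: hom_def)

lemma map_arrow_Arr:
  "g \<in> hom Delta k m \<Longrightarrow> w \<in> Arr (res_level X m) \<Longrightarrow>
    map_arrow (pull g) (FAr (FAr X g)) w \<in> Arr (res_level X k)"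
  by (auto simp: Arr_res_level hom_res_level pull_nodes ev_pull intro!: action_hom)

text \<open>On the ends of an arrow the laws are \<open>pull_id\<close> and \<open>pull_cmp\<close>;
  on its label they are the functor laws of \<open>X\<close>.\<close>

lemma simplicial_res: "simplicial (res X)"
  unfolding res_def
proof (rule simplicial_mk_functor)
  fix f k m assume f: "f \<in> hom Delta k m"
  then show "is_functor (res_action X f) \<and> Src (res_action X f) = res_level X m \<and> Tgt (res_action X f) = res_level X k"
    using is_functor_res_action[OF f] by (simp add: res_action_eq)
next
  fix k
  have i: "Id Delta k \<in> hom Delta k k" by (rule Delta.id_hom) simp
  show "res_action X (Id Delta k) = id_functor (res_level X k)"
  proof (rule functor_eqI)
    fix w assume "w \<in> Arr (Src (id_functor (res_level X k)))"
    then have w: "w \<in> Arr (res_level X k)" by simp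
    then show "FAr (res_action X (Id Delta k)) w = FAr (id_functor (res_level X k)) w"
      by (simp add: res_action_eq[OF i] map_arrow_def action_id pull_id[OF Arr_res_levelD(1)]
          pull_id[OF Arr_res_levelD(2)] label_Arr)
  qed (use is_functor_res_action[OF i] in \<open>auto simp: res_action_eq[OF i] pull_id is_functor_id_functor
      category_res_level\<close>)
next
  fix f g k m n assume fg: "f \<in> hom Delta m n" "g \<in> hom Delta k m"
  note c = Delta.cmp_in_hom[OF fg]
  show "res_action X (Cmp Delta f g) = res_action X g \<circ>\<^sub>F res_action X f"
  proof (rule functor_eqI)
    show "is_functor (res_action X g \<circ>\<^sub>F res_action X f)"
      using fg by (intro is_functor_comp_functor is_functor_res_action) (auto simp: res_action_eq)
  next
    fix w assume "w \<in> Arr (Src (res_action X g \<circ>\<^sub>F res_action X f))"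
    then have w: "w \<in> Arr (res_level X n)" by (simp add: res_action_eq[OF fg(1)])
    note t = Arr_res_levelD(1,2)[OF w]
    show "FAr (res_action X (Cmp Delta f g)) w = FAr (res_action X g \<circ>\<^sub>F res_action X f) w"
      using w map_arrow_Arr[OF fg(1) w]
      by (simp add: res_action_eq[OF fg(1)] res_action_eq[OF fg(2)] res_action_eq[OF c] map_arrow_def
          pull_cmp[OF t(1) fg] pull_cmp[OF t(2) fg] action_cmp_ar[OF fg label_Arr])
  qed (use is_functor_res_action[OF c] in \<open>auto simp: res_action_eq[OF fg(1)] res_action_eq[OF fg(2)] res_action_eq[OF c]
      pull_cmp[OF _ fg] pull_nodes[OF _ fg(1)]\<close>)
qed (rule category_res_level)

section \<open>Evaluation as a pseudo-natural equivalence\<close>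

definition evaluation :: "nat \<Rightarrow> 'u sfun" where
  "evaluation k = mk_functor (res_level X k) (FOb X k) (ev X) label"

lemma evaluation_simps [simp]:
  "Src (evaluation k) = res_level X k" "Tgt (evaluation k) = FOb X k"
  "a \<in> nodes X k \<Longrightarrow> FOb (evaluation k) a = ev X a"
  "w \<in> Arr (res_level X k) \<Longrightarrow> FAr (evaluation k) w = label w"
  by (simp_all add: evaluation_def)

lemma is_functor_evaluation: "is_functor (evaluation k)"
  unfolding evaluation_def
  by (intro is_functor_mk_functor category_res_level level)
    (auto simp: ev_obj hom_res_level Id_res_level Cmp_res_level)

lemma Id_node:
  assumes "y \<in> Obj (FOb X k)"
  shows "node (Id Delta k) y \<in> nodes X k" "ev X (node (Id Delta k) y) = y"
  using assms Delta.id_hom[of k] by (auto simp: nodes_def ev_def hom_def action_id)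

lemma is_equivalence_evaluation: "is_equivalence (evaluation k)"
proof (rule is_equivalenceI)
  show "fully_faithful (evaluation k)"
    unfolding fully_faithful_def
  proof (intro ballI)
    fix a b assume ab: "a \<in> Obj (Src (evaluation k))" "b \<in> Obj (Src (evaluation k))"
    have "FAr (evaluation k) w = label w" if "w \<in> hom (res_level X k) a b" for w
      using that by (simp add: hom_def)
    then show "bij_betw (FAr (evaluation k)) (hom (Src (evaluation k)) a b)
        (hom (Tgt (evaluation k)) (FOb (evaluation k) a) (FOb (evaluation k) b))"
      using ab by (intro bij_betw_byWitness[where f' = "arrow a b"]) (auto simp: hom_res_level)
  qed
  interpret C: category "FOb X k" by (rule level)
  show "essentially_surjective (evaluation k)"
    unfolding essentially_surjective_def
    using Id_node C.id_hom C.iso_arr_Id by force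
qed (rule is_functor_evaluation)

text \<open>An identity 2-cell. Since \<open>g\<close> acts contravariantly,
  \<open>evaluation\<close> is taken at the codomain of \<open>g\<close>. Source and target are one
  and the same functor, and \<open>evaluation_natural\<close> rewrites it into the form required of
  the target.\<close>

definition evaluation_cell :: "darr \<Rightarrow> ('u, 'u, 'u, 'u) ntrans" where
  "evaluation_cell g = (let F = FAr X g \<circ>\<^sub>F evaluation (Cod Delta g) in
     \<lparr> NSrc = F, NTgt = F, NCmp = (\<lambda>a \<in> Obj (Src F). Id (Tgt F) (FOb F a)) \<rparr>)"

definition resolution_map :: "(nat, darr, 'u) pseudo" where
  "resolution_map = \<lparr> PSrc = res X, PTgt = X, PFun = evaluation, PCell = evaluation_cell \<rparr>"

lemma evaluation_natural:
  assumes "g \<in> hom Delta k m"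
  shows "FAr X g \<circ>\<^sub>F evaluation m = evaluation k \<circ>\<^sub>F FAr (res X) g"
  using assms is_functor_res_action[OF assms] action[OF assms]
  by (intro functor_eqI is_functor_comp_functor is_functor_evaluation)
    (auto simp: FAr_res[OF assms] res_action_eq pull_nodes ev_pull map_arrow_Arr)

lemma evaluation_cell_simps:
  assumes "g \<in> hom Delta k m"
  shows "NSrc (evaluation_cell g) = FAr X g \<circ>\<^sub>F evaluation m"
    "NTgt (evaluation_cell g) = FAr X g \<circ>\<^sub>F evaluation m"
    "a \<in> nodes X m \<Longrightarrow> NCmp (evaluation_cell g) a = Id (FOb X k) (FOb (FAr X g) (ev X a))"
  using assms action[OF assms] by (auto simp: evaluation_cell_def Let_def hom_def)

lemma nat_iso_evaluation_cell:
  assumes "g \<in> hom Delta k m"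
  shows "nat_iso (evaluation_cell g)"
proof -
  have F: "is_functor (FAr X g \<circ>\<^sub>F evaluation m)"
    using action[OF assms] by (intro is_functor_comp_functor is_functor_evaluation) auto
  have m: "Cod Delta g = m" using assms by (simp add: hom_def)
  interpret F: is_functor "FAr X g \<circ>\<^sub>F evaluation m" by (rule F)
  show ?thesis unfolding nat_iso_def
    using nat_trans_id[OF F] F.ob F.target.iso_arr_Id
    by (simp add: evaluation_cell_def Let_def m)
qed

text \<open>As all cells are identities, the two coherence axioms reduce to functoriality of
  \<open>X\<close>, preservation of identities, and the fact that an identity composed with itself
  is itself.\<close>

lemma pseudo_nat_trans_resolution_map: "pseudo_nat_trans resolution_map"
proof (intro pseudo_nat_trans.intro pseudo_nat_trans_axioms.intro)
  interpret res: simplicial "res X" by (rule simplicial_res)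
  show "is_functor (PSrc resolution_map)" "is_functor (PTgt resolution_map)"
    by (simp_all add: resolution_map_def res.is_functor_axioms is_functor_axioms)
next
  fix f and c d :: nat assume "f \<in> hom (Src (PSrc resolution_map)) c d"
  then have f: "f \<in> hom Delta d c" by (simp add: resolution_map_def)
  show "nat_iso (PCell resolution_map f) \<and>
      NSrc (PCell resolution_map f) = FAr (PTgt resolution_map) f \<circ>\<^sub>F PFun resolution_map c \<and>
      NTgt (PCell resolution_map f) = PFun resolution_map d \<circ>\<^sub>F FAr (PSrc resolution_map) f"
    using nat_iso_evaluation_cell[OF f] evaluation_natural[OF f] evaluation_cell_simps[OF f]
    by (simp add: resolution_map_def)
next
  fix c :: nat and x assume "x \<in> Obj (FOb (PSrc resolution_map) c)"
  then have x: "x \<in> nodes X c" by (simp add: resolution_map_def)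
  then show "NCmp (PCell resolution_map (Id (Src (PSrc resolution_map)) c)) x =
      Id (FOb (PTgt resolution_map) c) (FOb (PFun resolution_map c) x)"
    using evaluation_cell_simps(3)[OF Delta.id_hom, of c x]
    by (simp add: resolution_map_def action_id ev_obj)
next
  fix f g x and c d e :: nat
  assume "f \<in> hom (Src (PSrc resolution_map)) c d" "g \<in> hom (Src (PSrc resolution_map)) d e"
    "x \<in> Obj (FOb (PSrc resolution_map) c)"
  then have f: "f \<in> hom Delta d c" and g: "g \<in> hom Delta e d" and x: "x \<in> nodes X c"
    by (simp_all add: resolution_map_def)
  interpret E: category "FOb X e" by (rule level)
  have y: "FOb (FAr X g) (FOb (FAr X f) (ev X x)) \<in> Obj (FOb X e)"
    using f g x by (intro action_ob ev_obj)
  show "NCmp (PCell resolution_map (Cmp (Src (PSrc resolution_map)) g f)) x =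
      Cmp (FOb (PTgt resolution_map) e)
       (NCmp (PCell resolution_map g) (FOb (FAr (PSrc resolution_map) f) x))
       (FAr (FAr (PTgt resolution_map) g) (NCmp (PCell resolution_map f) x))"
    using f g x evaluation_cell_simps(3)[OF Delta.cmp_in_hom[OF f g] x]
      evaluation_cell_simps(3)[OF g pull_nodes[OF x f]] evaluation_cell_simps(3)[OF f x]
      E.cmp_id_left[OF E.id_hom[OF y]]
    by (simp add: resolution_map_def FAr_res res_action_eq action_cmp_ob ev_obj ev_pull action_ob action_pres_id)
qed (simp_all add: resolution_map_def is_functor_evaluation Src_X Tgt_X)

lemma levelwise_equivalence_resolution_map: "levelwise_equivalence resolution_map"
  by (simp add: levelwise_equivalence_def resolution_map_def is_equivalence_evaluation)

sublocale res: simplicial "res X" by (rule simplicial_res)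

section \<open>Segal maps of the resolution\<close>

lemma face_res:
  "a \<in> nodes X 1 \<Longrightarrow> FOb (face (res X) i) a = pull (coface i) a"
  "w \<in> Arr (res_level X 1) \<Longrightarrow> FAr (face (res X) i) w = map_arrow (pull (coface i)) (FAr (face X i)) w"
  by (simp_all add: face_eq FAr_res[OF coface_hom] res_action_eq[OF coface_hom])

lemma segal_res_nth:
  "a \<in> nodes X k \<Longrightarrow> j < k \<Longrightarrow> FOb (segal_map (res X) k) a ! j = pull (edge k (Suc j)) a"
  "w \<in> Arr (res_level X k) \<Longrightarrow> j < k \<Longrightarrow> FAr (segal_map (res X) k) w ! j =
     map_arrow (pull (edge k (Suc j))) (FAr (FAr X (edge k (Suc j)))) w"
  using res.segal_map_nth[of a k j] res.segal_map_nth[of _ k j, of w]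
  by (simp_all add: FAr_res[OF edge_hom] res_action_eq[OF edge_hom])

text \<open>The edges recover the shape by \<open>Delta_eq_if_edges_eq\<close>. The point is kept by
  passage to any edge, and an edge exists because \<open>k\<close> is positive.\<close>

lemma nodes_eq_if_edges_eq:
  assumes k: "0 < k" and ab: "a \<in> nodes X k" "b \<in> nodes X k"
    and eq: "\<And>j. j < k \<Longrightarrow> pull (edge k (Suc j)) a = pull (edge k (Suc j)) b"
  shows "a = b"
proof (rule node_eqI)
  show "shape a = shape b"
    using k shape_hom[OF ab(1)] shape_hom[OF ab(2)]
  proof (rule Delta_eq_if_edges_eq)
    fix j assume j: "j < k"
    show "Cmp Delta (shape a) (edge k (Suc j)) = Cmp Delta (shape b) (edge k (Suc j))"
      using arg_cong[OF eq[OF j], of shape]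
      unfolding pull_shape_point(1)[OF ab(1) edge_hom[OF j]] pull_shape_point(1)[OF ab(2) edge_hom[OF j]] .
  qed
  show "point a = point b"
    using eq[OF k] pull_shape_point(2)[OF ab(1) edge_hom[OF k]] pull_shape_point(2)[OF ab(2) edge_hom[OF k]]
    by simp
qed

text \<open>Passing to a face keeps the point, so all members of a compatible chain of nodes share it.\<close>

lemma glue_nodes:
  assumes k: "0 < k" and as: "as \<in> Obj (iterated_pullback k (face (res X) 1) (face (res X) 0))"
  obtains a where "a \<in> nodes X k" "FOb (segal_map (res X) k) a = as"
proof -
  have len: "length as = k" and n: "\<And>j. j < k \<Longrightarrow> as ! j \<in> nodes X 1"
    and m: "\<And>j. Suc j < k \<Longrightarrow> pull (coface 0) (as ! j) = pull (coface 1) (as ! Suc j)"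
    using as by (auto simp: Obj_iterated_pullback res.face face_res)
  have match: "Cmp Delta (shape (as ! j)) (coface 0) = Cmp Delta (shape (as ! Suc j)) (coface 1)"
    "point (as ! j) = point (as ! Suc j)" if "Suc j < k" for j
    using m[OF that] pull_shape_point[OF n coface_hom, of j 0] pull_shape_point[OF n coface_hom, of "Suc j" 1] that
    by auto
  \<comment> \<open>The shapes can be glued only once they have a common codomain. Composing with a
    coface keeps the codomain, so the matching conditions carry it along the chain, just as they
    carry the point.\<close>
  define M where "M = Cod Delta (shape (as ! 0))"
  have all: "Cod Delta (shape (as ! j)) = M \<and> point (as ! j) = point (as ! 0)" if "j < k" for j
    using that
  proof (induction j)
    case (Suc j)
    have "Cod Delta (Cmp Delta (shape (as ! j)) (coface 0)) = Cod Delta (shape (as ! j))"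
      "Cod Delta (Cmp Delta (shape (as ! Suc j)) (coface 1)) = Cod Delta (shape (as ! Suc j))"
      using Delta.cmp_in_hom[OF shape_hom[OF n] coface_hom] Suc by (auto simp: hom_def)
    then show ?case using Suc match[of j] by simp
  qed (simp add: M_def)
  have "shape (as ! j) \<in> hom Delta 1 M" if "j < k" for j
    using shape_hom[OF n[OF that]] all[OF that] by simp
  then obtain g where g: "g \<in> hom Delta k M" "\<And>j. j < k \<Longrightarrow> Cmp Delta g (edge k (Suc j)) = shape (as ! j)"
    using Delta_glue_edges[OF k, of "\<lambda>j. shape (as ! j)" M] match(1) by blast
  define a where "a = node g (point (as ! 0))"
  have sp: "shape a = g" "point a = point (as ! 0)" using g(1) by (auto simp: a_def hom_def)
  have a: "a \<in> nodes X k" using g(1) n[OF k] by (auto simp: nodes_def sp M_def hom_def)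
  have "pull (edge k (Suc j)) a = as ! j" if "j < k" for j
    using pull_shape_point[OF a edge_hom[OF that]] g(2)[OF that] all[OF that] sp
    by (simp add: node_eqI)
  then show thesis using a len res.length_segal_map(1)[of a k]
    by (intro that[of a] nth_equalityI) (auto simp: segal_res_nth)
qed

text \<open>Evaluation commutes with the Segal maps. This identifies the ends of a chain of labels
  with Segal images in \<open>X\<close>, where full faithfulness applies.\<close>

lemma map_ev_segal_res:
  "a \<in> nodes X k \<Longrightarrow> map (ev X) (FOb (segal_map (res X) k) a) = FOb (segal_map X k) (ev X a)"
  using res.length_segal_map(1)[of a k] length_segal_map(1)[of "ev X a" k]
  by (intro nth_equalityI) (auto simp: ev_obj segal_res_nth segal_map_nth ev_pull[OF _ edge_hom])

lemma is_isomorphism_segal_res: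
  assumes k: "0 < k" and eq: "is_equivalence (segal_map X k)"
  shows "is_isomorphism (segal_map (res X) k)"
proof (rule is_isomorphismI[OF res.is_functor_segal_map])
  let ?P = "iterated_pullback k (face (res X) 1) (face (res X) 0)"
  let ?S = "segal_map (res X) k"
  interpret S: is_functor ?S by (rule res.is_functor_segal_map)
  interpret P: category ?P by (rule res.category_segal_target)
  have ff: "bij_betw (FAr (segal_map X k)) (hom (FOb X k) x y)
      (hom (iterated_pullback k (face X 1) (face X 0)) (FOb (segal_map X k) x) (FOb (segal_map X k) y))"
    if "x \<in> Obj (FOb X k)" "y \<in> Obj (FOb X k)" for x y
    using is_equivalenceD(2)[OF eq] that by (simp add: fully_faithful_def segal_map_Src_Tgt)
  have inj: "a = b" if "a \<in> nodes X k" "b \<in> nodes X k" "FOb ?S a = FOb ?S b" for a b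
    using k that(1,2)
  proof (rule nodes_eq_if_edges_eq)
    fix j assume "j < k"
    then show "pull (edge k (Suc j)) a = pull (edge k (Suc j)) b"
      using segal_res_nth(1)[OF that(1), of j] segal_res_nth(1)[OF that(2), of j] that(3) by simp
  qed
  show "bij_betw (FOb ?S) (Obj (Src ?S)) (Obj (Tgt ?S))"
    unfolding bij_betw_def res.segal_map_Src_Tgt
  proof (intro conjI inj_onI subset_antisym)
    show "Obj ?P \<subseteq> FOb ?S ` Obj (FOb (res X) k)"
      using glue_nodes[OF k] by (metis imageI res_simps(1) Obj_res_level subsetI)
  qed (use inj S.ob in \<open>auto simp: res.segal_map_Src_Tgt\<close>)
  \<comment> \<open>The image of an arrow has the images of its label and ends. An arrow of the
    pullback thus splits into a chain of tails, a chain of heads and an arrow of the pullback for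
    \<open>X\<close>.\<close>
  have labels: "map label (FAr ?S w) = FAr (segal_map X k) (label w)" if w: "w \<in> Arr (res_level X k)" for w
    using res.length_segal_map(2)[of w k] length_segal_map(2)[of "label w" k] w
    by (intro nth_equalityI) (auto simp: label_Arr segal_res_nth segal_map_nth)
  have ends: "tail w \<in> nodes X k" "head w \<in> nodes X k"
    "map tail (FAr ?S w) = FOb ?S (tail w)" "map head (FAr ?S w) = FOb ?S (head w)"
    if w: "w \<in> Arr (res_level X k)" for w
    using res.length_segal_map(2)[of w k] res.length_segal_map(1)[of "tail w" k]
      res.length_segal_map(1)[of "head w" k] w
    by (auto simp: Arr_res_levelD segal_res_nth intro!: nth_equalityI)
  show "bij_betw (FAr ?S) (Arr (Src ?S)) (Arr (Tgt ?S))"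
    unfolding bij_betw_def res.segal_map_Src_Tgt
  proof (intro conjI inj_onI subset_antisym)
    fix v w assume "v \<in> Arr (FOb (res X) k)" "w \<in> Arr (FOb (res X) k)" and eq: "FAr ?S v = FAr ?S w"
    then have v: "v \<in> Arr (res_level X k)" and w: "w \<in> Arr (res_level X k)" by simp_all
    \<comment> \<open>The ends come first, by injectivity on objects; only then do both labels lie
      in one hom set, on which the Segal map of \<open>X\<close> is injective.\<close>
    have th: "tail v = tail w" "head v = head w"
      using inj ends[OF v] ends[OF w] eq by metis+
    have "label v = label w"
      using ff[OF ev_obj[OF ends(1)[OF w]] ev_obj[OF ends(2)[OF w]]] labels[OF v] labels[OF w] eq
        Arr_res_levelD(3)[OF v] Arr_res_levelD(3)[OF w] th
      unfolding bij_betw_def inj_on_def by metis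
    with th show "v = w" by (rule arrow_eqI)
  next
    show "FAr ?S ` Arr (FOb (res X) k) \<subseteq> Arr ?P"
      using S.ar_Arr(1) by (auto simp: res.segal_map_Src_Tgt)
    show "Arr ?P \<subseteq> FAr ?S ` Arr (FOb (res X) k)"
    proof
      fix ws assume ws: "ws \<in> Arr ?P"
      then have len: "length ws = k" and n: "\<And>j. j < k \<Longrightarrow> ws ! j \<in> Arr (res_level X 1)"
        and m: "\<And>j. Suc j < k \<Longrightarrow> map_arrow (pull (coface 0)) (FAr (face X 0)) (ws ! j)
          = map_arrow (pull (coface 1)) (FAr (face X 1)) (ws ! Suc j)"
        by (auto simp: Arr_iterated_pullback res.face face_res)
      have m': "pull (coface 0) (tail (ws ! j)) = pull (coface 1) (tail (ws ! Suc j))"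
        "pull (coface 0) (head (ws ! j)) = pull (coface 1) (head (ws ! Suc j))"
        "FAr (face X 0) (label (ws ! j)) = FAr (face X 1) (label (ws ! Suc j))" if "Suc j < k" for j
        using arg_cong[OF m[OF that], of tail] arg_cong[OF m[OF that], of head]
          arg_cong[OF m[OF that], of label] by simp_all
      \<comment> \<open>The equations \<open>m\<close> hold for each part of a triple, so tails and
        heads are themselves compatible chains. Gluing them gives the ends of the arrow
        sought.\<close>
      have "map tail ws \<in> Obj ?P" "map head ws \<in> Obj ?P"
        using len n m' by (auto simp: Obj_iterated_pullback res.face Arr_res_levelD face_res)
      then obtain a b where a: "a \<in> nodes X k" "FOb ?S a = map tail ws"
        and b: "b \<in> nodes X k" "FOb ?S b = map head ws"
        using glue_nodes[OF k] by metis
      \<comment> \<open>The labels now run between the Segal images of \<open>ev X a\<close> and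
        \<open>ev X b\<close>, so fullness for \<open>X\<close> supplies the missing label
        \<open>u\<close>.\<close>
      have "map label ws \<in> hom (iterated_pullback k (face X 1) (face X 0))
          (FOb (segal_map X k) (ev X a)) (FOb (segal_map X k) (ev X b))"
        unfolding map_ev_segal_res[OF a(1), symmetric] map_ev_segal_res[OF b(1), symmetric] a(2) b(2)
        using len m' Arr_res_levelD(3)[OF n] by (auto simp: hom_iterated_pullback face)
      then obtain u where u: "u \<in> hom (FOb X k) (ev X a) (ev X b)" "FAr (segal_map X k) u = map label ws"
        using ff[OF ev_obj[OF a(1)] ev_obj[OF b(1)]] unfolding bij_betw_def by (metis imageE)
      have w: "arrow a b u \<in> Arr (res_level X k)"
        using a b u by (simp add: Arr_res_level hom_res_level)
      have eqs: "map tail (FAr ?S (arrow a b u)) = map tail ws"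
        "map head (FAr ?S (arrow a b u)) = map head ws" "map label (FAr ?S (arrow a b u)) = map label ws"
        using ends[OF w] labels[OF w] a b u by simp_all
      have "FAr ?S (arrow a b u) = ws"
      proof (rule nth_equalityI)
        show l: "length (FAr ?S (arrow a b u)) = length ws" using map_eq_imp_length_eq[OF eqs(1)] .
        fix j assume j: "j < length (FAr ?S (arrow a b u))"
        then show "FAr ?S (arrow a b u) ! j = ws ! j"
          using eqs[THEN arg_cong[of _ _ "\<lambda>l. l ! j"]] l by (simp add: arrow_eqI)
      qed
      then show "ws \<in> FAr ?S ` Arr (FOb (res X) k)" using w by auto
    qed
  qed
qed

section \<open>Pullbacks over the objects of the resolution and of \<open>X\<close>\<close>

text \<open>By naturality the legs over level 0 of \<open>X\<close> factor through evaluation, so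
  matching there depends only on evaluated nodes and on labels.\<close>

lemma evaluated_face:
  "a \<in> nodes X 1 \<Longrightarrow> FOb (evaluation 0 \<circ>\<^sub>F face (res X) i) a = FOb (face X i) (ev X a)"
  "w \<in> Arr (res_level X 1) \<Longrightarrow> FAr (evaluation 0 \<circ>\<^sub>F face (res X) i) w = FAr (face X i) (label w)"
proof -
  show "FOb (evaluation 0 \<circ>\<^sub>F face (res X) i) a = FOb (face X i) (ev X a)" if "a \<in> nodes X 1"
    using that pull_nodes[OF that coface_hom] ev_pull[OF that coface_hom]
    by (simp add: res.face face_res face_eq[of X])
  show "FAr (evaluation 0 \<circ>\<^sub>F face (res X) i) w = FAr (face X i) (label w)" if w: "w \<in> Arr (res_level X 1)"
  proof -
    have "map_arrow (pull (coface i)) (FAr (face X i)) w \<in> Arr (res_level X 0)"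
      unfolding face_eq using coface_hom w by (rule map_arrow_Arr)
    then show ?thesis using w by (simp add: res.face face_res)
  qed
qed

text \<open>In \<open>?P\<close> consecutive entries must agree as nodes over \<open>[0]\<close>, in
  \<open>?Q\<close> only after evaluation. So \<open>?Q\<close> may have more objects, while homs
  between objects of \<open>?P\<close> are the same in both.\<close>

lemma is_equivalence_base_change:
  assumes eq: "is_equivalence (segal_map X n)"
  shows "is_equivalence (base_change (res X) (evaluation 0) n)"
proof -
  let ?s = "\<lambda>i. evaluation 0 \<circ>\<^sub>F face (res X) i"
  let ?P = "iterated_pullback n (face (res X) 1) (face (res X) 0)"
  let ?Q = "iterated_pullback n (?s 1) (?s 0)"
  let ?X = "iterated_pullback n (face X 1) (face X 0)"
  have s: "is_functor (?s i)" "Src (?s i) = res_level X 1" "Tgt (?s i) = FOb X 0" for i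
    by (simp_all add: is_functor_comp_functor res.face is_functor_evaluation)
  interpret P: category ?P by (rule res.category_segal_target)
  interpret Q: category ?Q by (rule category_iterated_pullback) (simp_all add: s del: comp_functor_simps)
  interpret L: category "res_level X 1" by (rule category_res_level)
  have P_obj: "xs \<in> Obj ?P \<longleftrightarrow> length xs = n \<and> (\<forall>j<n. xs ! j \<in> nodes X 1) \<and>
      (\<forall>j. Suc j < n \<longrightarrow> pull (coface 0) (xs ! j) = pull (coface 1) (xs ! Suc j))" for xs
    by (auto simp: Obj_iterated_pullback res.face face_res)
  have Q_obj: "xs \<in> Obj ?Q \<longleftrightarrow> length xs = n \<and> (\<forall>j<n. xs ! j \<in> nodes X 1) \<and>
      (\<forall>j. Suc j < n \<longrightarrow> FOb (face X 0) (ev X (xs ! j)) = FOb (face X 1) (ev X (xs ! Suc j)))" for xs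
    by (auto simp: Obj_iterated_pullback s evaluated_face simp del: comp_functor_simps)
  have P_hom: "ws \<in> hom ?P xs ys \<longleftrightarrow> length ws = n \<and> length xs = n \<and> length ys = n \<and>
      (\<forall>j<n. ws ! j \<in> hom (res_level X 1) (xs ! j) (ys ! j)) \<and>
      (\<forall>j. Suc j < n \<longrightarrow> map_arrow (pull (coface 0)) (FAr (face X 0)) (ws ! j) =
         map_arrow (pull (coface 1)) (FAr (face X 1)) (ws ! Suc j))" for ws xs ys
  proof -
    have "FAr (face (res X) 0) (ws ! j) = FAr (face (res X) 1) (ws ! Suc j) \<longleftrightarrow>
        map_arrow (pull (coface 0)) (FAr (face X 0)) (ws ! j) =
        map_arrow (pull (coface 1)) (FAr (face X 1)) (ws ! Suc j)"
      if "Suc j < n" "\<forall>j<n. ws ! j \<in> hom (res_level X 1) (xs ! j) (ys ! j)" for j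
      using that by (simp add: face_res hom_def)
    then show ?thesis unfolding hom_iterated_pullback res.face res_simps by blast
  qed
  have Q_hom: "ws \<in> hom ?Q xs ys \<longleftrightarrow> length ws = n \<and> length xs = n \<and> length ys = n \<and>
      (\<forall>j<n. ws ! j \<in> hom (res_level X 1) (xs ! j) (ys ! j)) \<and>
      (\<forall>j. Suc j < n \<longrightarrow> FAr (face X 0) (label (ws ! j)) = FAr (face X 1) (label (ws ! Suc j)))" for ws xs ys
  proof -
    have "FAr (?s 0) (ws ! j) = FAr (?s 1) (ws ! Suc j) \<longleftrightarrow>
        FAr (face X 0) (label (ws ! j)) = FAr (face X 1) (label (ws ! Suc j))"
      if "Suc j < n" "\<forall>j<n. ws ! j \<in> hom (res_level X 1) (xs ! j) (ys ! j)" for j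
      using that by (simp add: evaluated_face hom_def del: comp_functor_simps)
    then show ?thesis unfolding hom_iterated_pullback s by blast
  qed
  have PQ_obj: "xs \<in> Obj ?Q" if "xs \<in> Obj ?P" for xs
  proof -
    have "FOb (face X 0) (ev X (xs ! j)) = FOb (face X 1) (ev X (xs ! Suc j))" if "Suc j < n" for j
      using that \<open>xs \<in> Obj ?P\<close> ev_pull[OF _ coface_hom, of "xs ! j" 0] ev_pull[OF _ coface_hom, of "xs ! Suc j" 1]
      unfolding P_obj face_eq[of X] by auto
    then show ?thesis using that by (simp add: P_obj Q_obj)
  qed
  \<comment> \<open>Between chains that already match as nodes, the ends of the arrows match
    automatically, so the condition on triples reduces to the one on labels.\<close>
  have hom_eq: "hom ?P xs ys = hom ?Q xs ys" if "xs \<in> Obj ?P" "ys \<in> Obj ?P" for xs ys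
  proof -
    have "map_arrow (pull (coface 0)) (FAr (face X 0)) (ws ! j) = map_arrow (pull (coface 1)) (FAr (face X 1)) (ws ! Suc j)
        \<longleftrightarrow> FAr (face X 0) (label (ws ! j)) = FAr (face X 1) (label (ws ! Suc j))"
      if "Suc j < n" "\<forall>j<n. ws ! j \<in> hom (res_level X 1) (xs ! j) (ys ! j)" for ws j
    proof -
      have "tail (ws ! j) = xs ! j" "tail (ws ! Suc j) = xs ! Suc j"
        "head (ws ! j) = ys ! j" "head (ws ! Suc j) = ys ! Suc j"
        using that by (auto simp: hom_res_level)
      then have "pull (coface 0) (tail (ws ! j)) = pull (coface 1) (tail (ws ! Suc j))"
        "pull (coface 0) (head (ws ! j)) = pull (coface 1) (head (ws ! Suc j))"
        using that(1) \<open>xs \<in> Obj ?P\<close> \<open>ys \<in> Obj ?P\<close> by (auto simp: P_obj)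
      then show ?thesis by (metis arrow_eqI map_arrow_simps)
    qed
    then show ?thesis unfolding set_eq_iff P_hom Q_hom by blast
  qed
  let ?B = "base_change (res X) (evaluation 0) n"
  have B: "Src ?B = ?P" "Tgt ?B = ?Q" "\<And>xs. xs \<in> Obj ?P \<Longrightarrow> FOb ?B xs = xs"
    "\<And>ws. ws \<in> Arr ?P \<Longrightarrow> FAr ?B ws = ws"
    by (simp_all add: base_change_def)
  have PQ_hom: "ws \<in> hom ?Q xs ys" if "ws \<in> hom ?P xs ys" for ws xs ys
    using that hom_eq P.hom_obj by blast
  show ?thesis
  proof (rule is_equivalenceI)
    show "is_functor ?B"
      unfolding base_change_def
    proof (rule is_functor_mk_functor[OF P.category_axioms Q.category_axioms PQ_obj PQ_hom])
      fix xs assume x: "xs \<in> Obj ?P"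
      show "Id ?P xs = Id ?Q xs"
        unfolding Id_iterated_pullback[OF x] Id_iterated_pullback[OF PQ_obj[OF x]] by (simp add: res.face)
    next
      fix ws vs xs ys zs assume w: "ws \<in> hom ?P ys zs" and v: "vs \<in> hom ?P xs ys"
      show "Cmp ?P ws vs = Cmp ?Q ws vs"
        unfolding Cmp_iterated_pullback[OF w v] Cmp_iterated_pullback[OF PQ_hom[OF w] PQ_hom[OF v]]
        by (simp add: res.face)
    qed
    show "fully_faithful ?B"
      unfolding fully_faithful_def B
    proof (intro ballI)
      fix xs ys assume x: "xs \<in> Obj ?P" and y: "ys \<in> Obj ?P"
      have "FAr ?B ws = ws" if "ws \<in> hom ?P xs ys" for ws
        using that B(4) by (simp add: hom_def)
      then show "bij_betw (FAr ?B) (hom ?P xs ys) (hom ?Q (FOb ?B xs) (FOb ?B ys))"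
        unfolding B(3)[OF x] B(3)[OF y] hom_eq[OF x y, symmetric]
        by (simp add: bij_betw_def inj_on_def)
    qed
    show "essentially_surjective ?B"
      unfolding essentially_surjective_def B
    proof
      fix ys assume y: "ys \<in> Obj ?Q"
      then have y': "length ys = n" "\<And>j. j < n \<Longrightarrow> ys ! j \<in> nodes X 1"
        by (auto simp: Q_obj)
      \<comment> \<open>Evaluation turns \<open>ys\<close> into a chain in \<open>X\<close>, which
        is isomorphic, as a chain, to the edges of a single \<open>z\<close> of level
        \<open>n\<close>.\<close>
      have "map (ev X) ys \<in> Obj ?X"
        using y unfolding Q_obj by (auto simp: Obj_iterated_pullback face ev_obj)
      then obtain z us where z: "z \<in> Obj (FOb X n)"
        and us: "us \<in> hom ?X (FOb (segal_map X n) z) (map (ev X) ys)" and iso: "iso_arr ?X us"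
        using is_equivalenceD(3)[OF eq] unfolding essentially_surjective_def segal_map_Src_Tgt by blast
      obtain vs where vs: "vs \<in> hom ?X (map (ev X) ys) (FOb (segal_map X n) z)"
        and vu: "Cmp ?X vs us = Id ?X (FOb (segal_map X n) z)" and uv: "Cmp ?X us vs = Id ?X (map (ev X) ys)"
        using category.iso_arrE[OF category_segal_target iso us] .
      have sz: "FOb (segal_map X n) z \<in> Obj ?X" and ysX: "map (ev X) ys \<in> Obj ?X"
        using category.hom_obj[OF category_segal_target us] .
      have us': "length us = n" "\<And>j. j < n \<Longrightarrow> us ! j \<in> hom (FOb X 1) (FOb (FAr X (edge n (Suc j))) z) (ev X (ys ! j))"
        "\<And>j. Suc j < n \<Longrightarrow> FAr (face X 0) (us ! j) = FAr (face X 1) (us ! Suc j)"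
        using us z y'(1) by (auto simp: hom_iterated_pullback face segal_map_nth)
      have vs': "length vs = n" "\<And>j. j < n \<Longrightarrow> vs ! j \<in> hom (FOb X 1) (ev X (ys ! j)) (FOb (FAr X (edge n (Suc j))) z)"
        "\<And>j. Suc j < n \<Longrightarrow> FAr (face X 0) (vs ! j) = FAr (face X 1) (vs ! Suc j)"
        using vs z y'(1) by (auto simp: hom_iterated_pullback face segal_map_nth)
      \<comment> \<open>Composition and identities in the pullback are entrywise, so the inverse
        laws for the chains split into inverse laws for their entries.\<close>
      have vu': "Cmp (FOb X 1) (vs ! j) (us ! j) = Id (FOb X 1) (FOb (FAr X (edge n (Suc j))) z)" if "j < n" for j
        using arg_cong[OF vu, of "\<lambda>l. l ! j"] that us'(1) vs'(1) z length_segal_map(1)[OF z]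
        unfolding Cmp_iterated_pullback[OF vs us] Id_iterated_pullback[OF sz]
        by (simp add: face segal_map_nth)
      have uv': "Cmp (FOb X 1) (us ! j) (vs ! j) = Id (FOb X 1) (ev X (ys ! j))" if "j < n" for j
        using arg_cong[OF uv, of "\<lambda>l. l ! j"] that us'(1) vs'(1) y'(1)
        unfolding Cmp_iterated_pullback[OF us vs] Id_iterated_pullback[OF ysX]
        by (simp add: face)
      \<comment> \<open>These nodes are the Segal image of the node with identity shape and point
        \<open>z\<close>. They share one point, hence match as nodes even though \<open>ys\<close>
        need not.\<close>
      define x where "x j = node (edge n (Suc j)) z" for j
      have e: "edge n (Suc j) \<in> Arr Delta" "Dom Delta (edge n (Suc j)) = 1" "Cod Delta (edge n (Suc j)) = n"
        if "j < n" for j using edge_hom[OF that] by (auto simp: hom_def)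
      have x: "x j \<in> nodes X 1" "ev X (x j) = FOb (FAr X (edge n (Suc j))) z" if "j < n" for j
        using e[OF that] z by (auto simp: x_def nodes_def ev_def)
      have "pull (coface 0) (x j) = pull (coface 1) (x (Suc j))" if "Suc j < n" for j
        using e[of j] e[of "Suc j"] that edge_coface[OF that] by (simp add: x_def pull_def)
      then have xs: "map x [0..<n] \<in> Obj ?P" using x by (simp add: P_obj)
      define ws where "ws = map (\<lambda>j. arrow (x j) (ys ! j) (us ! j)) [0..<n]"
      define ws' where "ws' = map (\<lambda>j. arrow (ys ! j) (x j) (vs ! j)) [0..<n]"
      have L: "ws ! j \<in> hom (res_level X 1) (x j) (ys ! j)" "ws' ! j \<in> hom (res_level X 1) (ys ! j) (x j)"
        if "j < n" for j
        using that us'(2)[OF that] vs'(2)[OF that] x[OF that] y'(2)[OF that]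
        by (simp_all add: ws_def ws'_def hom_res_level)
      \<comment> \<open>Since \<open>x j\<close> evaluates to an edge of \<open>z\<close>, the
        entries of \<open>us\<close> and \<open>vs\<close> serve unchanged as labels. Their matching
        over level 0 of \<open>X\<close> is exactly the condition in \<open>?Q\<close>.\<close>
      have ws: "ws \<in> hom ?Q (map x [0..<n]) ys" and ws': "ws' \<in> hom ?Q ys (map x [0..<n])"
        using L us' vs' y' by (simp_all add: Q_hom) (simp_all add: ws_def ws'_def)
      have "Cmp ?Q ws' ws = Id ?Q (map x [0..<n])"
        unfolding Cmp_iterated_pullback[OF ws' ws] Id_iterated_pullback[OF PQ_obj[OF xs]]
      proof (rule nth_equalityI)
        fix j assume "j < length (map2 (Cmp (Src (?s 1))) ws' ws)"
        then have j: "j < n" by (simp add: ws_def ws'_def)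
        have "Cmp (res_level X 1) (ws' ! j) (ws ! j) = Id (res_level X 1) (x j)"
          unfolding Cmp_res_level[OF L(2)[OF j] L(1)[OF j]] Id_res_level[OF x(1)[OF j]]
          using vu'[OF j] x(2)[OF j] j by (simp add: ws_def ws'_def)
        then show "map2 (Cmp (Src (?s 1))) ws' ws ! j = map (Id (Src (?s 1))) (map x [0..<n]) ! j"
          using j by (simp add: s ws_def ws'_def del: comp_functor_simps)
      qed (simp add: ws_def ws'_def)
      moreover have "Cmp ?Q ws ws' = Id ?Q ys"
        unfolding Cmp_iterated_pullback[OF ws ws'] Id_iterated_pullback[OF y]
      proof (rule nth_equalityI)
        fix j assume "j < length (map2 (Cmp (Src (?s 1))) ws ws')"
        then have j: "j < n" by (simp add: ws_def ws'_def)
        have "Cmp (res_level X 1) (ws ! j) (ws' ! j) = Id (res_level X 1) (ys ! j)"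
          unfolding Cmp_res_level[OF L(1)[OF j] L(2)[OF j]] Id_res_level[OF y'(2)[OF j]]
          using uv'[OF j] j by (simp add: ws_def ws'_def)
        then show "map2 (Cmp (Src (?s 1))) ws ws' ! j = map (Id (Src (?s 1))) ys ! j"
          using j y'(1) by (simp add: s ws_def ws'_def del: comp_functor_simps)
      qed (simp add: ws_def ws'_def y'(1))
      ultimately have "iso_arr ?Q ws" by (rule Q.iso_arrI[OF ws ws'])
      then show "\<exists>xs \<in> Obj ?P. \<exists>g \<in> hom ?Q (FOb ?B xs) ys. iso_arr ?Q g"
        using xs ws B(3)[OF xs] by metis
    qed
  qed
qed

end

section \<open>Functoriality of the resolution\<close>

locale simplicial_map = nat_trans t for t :: "'u simp_map" +
  assumes Src_Src: "Src (NSrc t) = Delta_op" and Tgt_Src: "Tgt (NSrc t) = Cat"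
begin

sublocale X: simplicial "NSrc t"
  by unfold_locales (simp_all add: Src_Src Tgt_Src)

sublocale Y: simplicial "NTgt t"
  using Src_Src Tgt_Src src_eq tgt_eq by unfold_locales simp_all

lemma comp:
  "is_functor (NCmp t k)" "Src (NCmp t k) = FOb (NSrc t) k" "Tgt (NCmp t k) = FOb (NTgt t) k"
  using component[of k] by (auto simp: Src_Src Tgt_Src)

lemma comp_ob: "x \<in> Obj (FOb (NSrc t) k) \<Longrightarrow> FOb (NCmp t k) x \<in> Obj (FOb (NTgt t) k)"
  using is_functor.ob[OF comp(1), of x k] comp(2,3)[of k] by simp

lemma comp_hom: "u \<in> hom (FOb (NSrc t) k) x y \<Longrightarrow>
    FAr (NCmp t k) u \<in> hom (FOb (NTgt t) k) (FOb (NCmp t k) x) (FOb (NCmp t k) y)"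
  using is_functor.ar_hom[OF comp(1), of u k x y] comp(2,3)[of k] by simp

lemma comp_id: "x \<in> Obj (FOb (NSrc t) k) \<Longrightarrow>
    FAr (NCmp t k) (Id (FOb (NSrc t) k) x) = Id (FOb (NTgt t) k) (FOb (NCmp t k) x)"
  using is_functor.pres_id[OF comp(1), of x k] comp(2,3)[of k] by simp

lemma comp_cmp: "v \<in> hom (FOb (NSrc t) k) y z \<Longrightarrow> u \<in> hom (FOb (NSrc t) k) x y \<Longrightarrow>
    FAr (NCmp t k) (Cmp (FOb (NSrc t) k) v u) = Cmp (FOb (NTgt t) k) (FAr (NCmp t k) v) (FAr (NCmp t k) u)"
  using is_functor.ar_cmp[OF comp(1), of v k y z u x] comp(2,3)[of k] by simp

lemma comp_natural:
  assumes g: "g \<in> hom Delta k m"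
  shows "x \<in> Obj (FOb (NSrc t) m) \<Longrightarrow>
      FOb (NCmp t k) (FOb (FAr (NSrc t) g) x) = FOb (FAr (NTgt t) g) (FOb (NCmp t m) x)"
    and "u \<in> Arr (FOb (NSrc t) m) \<Longrightarrow>
      FAr (NCmp t k) (FAr (FAr (NSrc t) g) u) = FAr (FAr (NTgt t) g) (FAr (NCmp t m) u)"
proof -
  have eq: "NCmp t k \<circ>\<^sub>F FAr (NSrc t) g = FAr (NTgt t) g \<circ>\<^sub>F NCmp t m"
    using naturality_hom[of g m k] g comp X.action[OF g] Y.action[OF g] by (simp add: Src_Src Tgt_Src)
  show "x \<in> Obj (FOb (NSrc t) m) \<Longrightarrow>
      FOb (NCmp t k) (FOb (FAr (NSrc t) g) x) = FOb (FAr (NTgt t) g) (FOb (NCmp t m) x)"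
    using arg_cong[OF eq, of "\<lambda>F. FOb F x"] comp X.action[OF g] by simp
  show "u \<in> Arr (FOb (NSrc t) m) \<Longrightarrow>
      FAr (NCmp t k) (FAr (FAr (NSrc t) g) u) = FAr (FAr (NTgt t) g) (FAr (NCmp t m) u)"
    using arg_cong[OF eq, of "\<lambda>F. FAr F u"] comp X.action[OF g] by simp
qed

end

lemma hom_SimpCat: "t \<in> hom SimpCat X Y \<longleftrightarrow> simplicial_map t \<and> NSrc t = X \<and> NTgt t = Y"
  by (auto simp: SimpCat_def functor_category_def simplicial_map_def simplicial_map_axioms_def)

lemma Id_SimpCat: "simplicial X \<Longrightarrow>
    Id SimpCat X = \<lparr> NSrc = X, NTgt = X, NCmp = (\<lambda>k \<in> UNIV. id_functor (FOb X k)) \<rparr>"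
  using simplicial.level[of X]
  by (simp add: SimpCat_def functor_category_def simplicial_def simplicial_axioms_def)

lemma Cmp_SimpCat:
  assumes "simplicial_map u" "simplicial_map t" "NTgt t = NSrc u"
  shows "Cmp SimpCat u t = \<lparr> NSrc = NSrc t, NTgt = NTgt u, NCmp = (\<lambda>k \<in> UNIV. NCmp u k \<circ>\<^sub>F NCmp t k) \<rparr>"
  using assms simplicial_map.comp[OF assms(1)] simplicial_map.comp[OF assms(2)]
  by (simp add: SimpCat_def functor_category_def simplicial_map_def simplicial_map_axioms_def)

lemma category_SimpCat: "category SimpCat"
  unfolding SimpCat_def by (rule category_functor_category[OF category_Delta_op category_Cat])

context coding
begin

text \<open>The transformation acts at the level where the point lives, the codomain of the shape,
  so the shape stays fixed. Labels live at the level of the node itself and are moved by that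
  component in \<open>res_comp\<close>.\<close>

definition push :: "'u simp_map \<Rightarrow> 'u \<Rightarrow> 'u" where
  "push t a = node (shape a) (FOb (NCmp t (Cod Delta (shape a))) (point a))"

definition res_comp :: "'u simp_map \<Rightarrow> nat \<Rightarrow> 'u sfun" where
  "res_comp t k = mk_functor (res_level (NSrc t) k) (res_level (NTgt t) k)
     (push t) (map_arrow (push t) (FAr (NCmp t k)))"

definition res_map :: "'u simp_map \<Rightarrow> 'u simp_map" where
  "res_map t = \<lparr> NSrc = res (NSrc t), NTgt = res (NTgt t), NCmp = restrict (res_comp t) UNIV \<rparr>"

lemma push_shape_point: "shape (push t a) = shape a"
  "point (push t a) = FOb (NCmp t (Cod Delta (shape a))) (point a)"
  by (simp_all add: push_def shape_Arr)

end

locale resolution_of_map = coding node shape point arrow tail head label + simplicial_map t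
  for node :: "darr \<Rightarrow> 'u \<Rightarrow> 'u" and shape point arrow tail head label and t :: "'u simp_map"
begin

sublocale RX: resolution node shape point arrow tail head label "NSrc t" ..
sublocale RY: resolution node shape point arrow tail head label "NTgt t" ..

lemma push_nodes: "a \<in> nodes (NSrc t) k \<Longrightarrow> push t a \<in> nodes (NTgt t) k"
  by (simp add: nodes_def push_shape_point comp_ob)

text \<open>This is naturality of \<open>t\<close> at the shape of \<open>a\<close>. It makes the
  component of \<open>t\<close> send labels between the evaluations of the pushed ends.\<close>

lemma ev_push: "a \<in> nodes (NSrc t) k \<Longrightarrow> ev (NTgt t) (push t a) = FOb (NCmp t k) (ev (NSrc t) a)"
  using comp_natural(1)[OF shape_hom, of a "NSrc t" k "point a"]
  by (simp add: ev_def push_shape_point nodes_def)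

lemma push_hom: "w \<in> hom (res_level (NSrc t) k) a b \<Longrightarrow>
    map_arrow (push t) (FAr (NCmp t k)) w \<in> hom (res_level (NTgt t) k) (push t a) (push t b)"
  by (auto simp: hom_res_level push_nodes ev_push intro!: comp_hom)

lemma push_Arr: "w \<in> Arr (res_level (NSrc t) k) \<Longrightarrow>
    map_arrow (push t) (FAr (NCmp t k)) w \<in> Arr (res_level (NTgt t) k)"
  using push_hom[of w k "tail w" "head w"] by (auto simp: Arr_res_level)

text \<open>\<open>pull\<close> changes only the shape and keeps its codomain, while
  \<open>push\<close> changes only the point and consults only that codomain; hence they commute
  strictly.\<close>

lemma push_pull: "a \<in> nodes (NSrc t) m \<Longrightarrow> g \<in> hom Delta k m \<Longrightarrow> push t (pull g a) = pull g (push t a)"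
  using pull_shape_point[of a "NSrc t" m g k] pull_shape_point[OF push_nodes, of a m g k]
    Delta.cmp_in_hom[OF shape_hom, of a "NSrc t" m g k]
  by (intro node_eqI[of "push t (pull g a)"]) (auto simp: push_shape_point hom_def)

lemma is_functor_res_comp: "is_functor (res_comp t k)"
  unfolding res_comp_def
proof (rule is_functor_mk_functor)
  fix a assume "a \<in> Obj (res_level (NSrc t) k)"
  then show "map_arrow (push t) (FAr (NCmp t k)) (Id (res_level (NSrc t) k) a) =
      Id (res_level (NTgt t) k) (push t a)"
    by (simp add: Id_res_level map_arrow_def push_nodes comp_id RX.ev_obj ev_push)
next
  fix w v a b c assume w: "w \<in> hom (res_level (NSrc t) k) b c" and v: "v \<in> hom (res_level (NSrc t) k) a b"
  then show "map_arrow (push t) (FAr (NCmp t k)) (Cmp (res_level (NSrc t) k) w v) =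
      Cmp (res_level (NTgt t) k) (map_arrow (push t) (FAr (NCmp t k)) w) (map_arrow (push t) (FAr (NCmp t k)) v)"
    unfolding Cmp_res_level[OF w v] Cmp_res_level[OF push_hom[OF w] push_hom[OF v]]
    using comp_cmp[of "label w" k _ _ "label v"] by (auto simp: map_arrow_def hom_res_level)
qed (auto simp: RX.category_res_level RY.category_res_level push_nodes push_hom)

lemma res_comp_simps [simp]:
  "Src (res_comp t k) = res_level (NSrc t) k" "Tgt (res_comp t k) = res_level (NTgt t) k"
  "a \<in> nodes (NSrc t) k \<Longrightarrow> FOb (res_comp t k) a = push t a"
  "w \<in> Arr (res_level (NSrc t) k) \<Longrightarrow>
     FAr (res_comp t k) w = map_arrow (push t) (FAr (NCmp t k)) w"
  by (simp_all add: res_comp_def)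

lemma res_comp_natural:
  assumes g: "g \<in> hom Delta k m"
  shows "res_comp t k \<circ>\<^sub>F res_action (NSrc t) g = res_action (NTgt t) g \<circ>\<^sub>F res_comp t m"
proof (rule functor_eqI)
  show "is_functor (res_comp t k \<circ>\<^sub>F res_action (NSrc t) g)"
    "is_functor (res_action (NTgt t) g \<circ>\<^sub>F res_comp t m)"
    using RX.is_functor_res_action[OF g] RY.is_functor_res_action[OF g]
    by (auto intro!: is_functor_comp_functor is_functor_res_comp simp: res_action_eq[OF g])
next
  fix w assume "w \<in> Arr (Src (res_action (NTgt t) g \<circ>\<^sub>F res_comp t m))"
  then have w: "w \<in> Arr (res_level (NSrc t) m)" by simp
  note ends = RX.Arr_res_levelD(1,2)[OF w]
  show "FAr (res_comp t k \<circ>\<^sub>F res_action (NSrc t) g) w = FAr (res_action (NTgt t) g \<circ>\<^sub>F res_comp t m) w"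
    using w RX.map_arrow_Arr[OF g w] push_Arr[OF w] comp_natural(2)[OF g RX.label_Arr[OF w]]
    by (simp add: res_action_eq[OF g] map_arrow_def push_pull[OF ends(1) g] push_pull[OF ends(2) g])
qed (use g in \<open>auto simp: res_action_eq[OF g] push_pull[OF _ g] push_nodes pull_nodes[OF _ g]\<close>)

lemma simplicial_map_res_map: "simplicial_map (res_map t)"
proof (intro simplicial_map.intro simplicial_map_axioms.intro)
  show "nat_trans (res_map t)"
    unfolding res_map_def
  proof (rule nat_transI[where A = Delta_op and B = Cat and c = "res_comp t", unfolded op_category_simps Obj_Delta])
    fix f and x y :: nat assume "f \<in> hom Delta y x"
    then show "Cmp Cat (res_comp t y) (FAr (res (NSrc t)) f) = Cmp Cat (FAr (res (NTgt t)) f) (res_comp t x)"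
      using res_comp_natural[of f y x] is_functor_res_comp
        RX.is_functor_res_action[of f y x] RY.is_functor_res_action[of f y x]
      by (simp add: FAr_res res_action_eq)
  qed (simp_all add: RX.res.is_functor_axioms RY.res.is_functor_axioms is_functor_res_comp)
qed (simp_all add: res_map_def)

end

context coding
begin

text \<open>The construction works for every simplicial category. The functor laws are checked level
  by level: on nodes they are laws of \<open>push\<close>, on labels laws of the components.\<close>

lemma is_functor_res: "is_functor (mk_functor SimpCat SimpCat res res_map)"
proof (rule is_functor_mk_functor)
  fix X :: "'u simp_cat" assume "X \<in> Obj SimpCat"
  then have "simplicial X" by (simp add: Obj_SimpCat)
  then interpret resolution node shape point arrow tail head label X
    by (simp add: resolution_def coding_axioms)
  have rX: "simplicial (res X)" by (rule simplicial_res)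
  have i: "Id SimpCat X \<in> hom SimpCat X X"
    using category.id_hom[OF category_SimpCat] simplicial_axioms by (simp add: Obj_SimpCat)
  interpret I: resolution_of_map node shape point arrow tail head label "Id SimpCat X"
    using i by (simp add: resolution_of_map_def coding_axioms hom_SimpCat)
  note I = Id_SimpCat[OF simplicial_axioms]
  have src: "NSrc (Id SimpCat X) = X" "NTgt (Id SimpCat X) = X" "NCmp (Id SimpCat X) k = id_functor (FOb X k)" for k
    by (simp_all add: I)
  have push: "push (Id SimpCat X) a = a" if "a \<in> nodes X k" for a k
    using that by (simp add: push_def src nodes_def)
  have "res_comp (Id SimpCat X) k = id_functor (res_level X k)" for k
  proof (rule functor_eqI)
    fix w assume "w \<in> Arr (Src (id_functor (res_level X k)))"
    then have w: "w \<in> Arr (res_level X k)" by simp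
    then show "FAr (res_comp (Id SimpCat X) k) w = FAr (id_functor (res_level X k)) w"
      using I.res_comp_simps(4)[of w k] label_Arr[OF w]
      by (simp add: src map_arrow_def push[OF Arr_res_levelD(1)] push[OF Arr_res_levelD(2)])
  qed (use I.is_functor_res_comp I.res_comp_simps in \<open>auto simp: src push is_functor_id_functor category_res_level\<close>)
  then show "res_map (Id SimpCat X) = Id SimpCat (res X)"
    unfolding Id_SimpCat[OF rX] by (simp add: res_map_def src cong: restrict_cong)
next
  fix X assume "X \<in> Obj (SimpCat :: ('u simp_cat, 'u simp_map) category)"
  then have "simplicial X" by (simp add: Obj_SimpCat)
  then interpret resolution node shape point arrow tail head label X
    by (simp add: resolution_def coding_axioms)
  show "res X \<in> Obj SimpCat" using simplicial_res by (simp add: Obj_SimpCat)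
next
  fix t :: "'u simp_map" and X Y assume "t \<in> hom SimpCat X Y"
  then have t: "simplicial_map t" "NSrc t = X" "NTgt t = Y" by (simp_all add: hom_SimpCat)
  then interpret resolution_of_map node shape point arrow tail head label t
    by (simp add: resolution_of_map_def coding_axioms)
  show "res_map t \<in> hom SimpCat (res X) (res Y)"
    using simplicial_map_res_map t by (simp add: hom_SimpCat) (simp add: res_map_def)
next
  fix u t :: "'u simp_map" and X Y Z assume ut: "u \<in> hom SimpCat Y Z" "t \<in> hom SimpCat X Y"
  then have u: "simplicial_map u" "NSrc u = Y" "NTgt u = Z" and t: "simplicial_map t" "NSrc t = X" "NTgt t = Y"
    by (simp_all add: hom_SimpCat)
  interpret U: resolution_of_map node shape point arrow tail head label u
    using u by (simp add: resolution_of_map_def coding_axioms)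
  interpret T: resolution_of_map node shape point arrow tail head label t
    using t by (simp add: resolution_of_map_def coding_axioms)
  let ?c = "Cmp SimpCat u t"
  have "?c \<in> hom SimpCat X Z" by (rule category.cmp_in_hom[OF category_SimpCat ut])
  then interpret C: resolution_of_map node shape point arrow tail head label ?c
    by (simp add: resolution_of_map_def coding_axioms hom_SimpCat)
  have tu: "NTgt t = NSrc u" using t u by simp
  have c: "NSrc ?c = X" "NTgt ?c = Z" "NCmp ?c k = NCmp u k \<circ>\<^sub>F NCmp t k" for k
    unfolding Cmp_SimpCat[OF u(1) t(1) tu] using t u by simp_all
  \<comment> \<open>\<open>push t\<close> keeps the shape, so both transformations are applied at
    the same level.\<close>
  have push: "push ?c a = push u (push t a)" if "a \<in> nodes X k" for a k
    using that T.comp(2)[of "Cod Delta (shape a)"]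
    by (intro node_eqI[of "push ?c a"]) (simp_all add: push_shape_point c nodes_def t)
  have "res_comp ?c k = res_comp u k \<circ>\<^sub>F res_comp t k" for k
  proof (rule functor_eqI)
    fix w assume "w \<in> Arr (Src (res_comp u k \<circ>\<^sub>F res_comp t k))"
    then have w: "w \<in> Arr (res_level (NSrc t) k)" by simp
    then have w': "w \<in> Arr (res_level X k)" by (simp add: t)
    show "FAr (res_comp ?c k) w = FAr (res_comp u k \<circ>\<^sub>F res_comp t k) w"
      using C.res_comp_simps(4)[of w k] w w' T.push_Arr[OF w] T.RX.Arr_res_levelD(1,2)[OF w]
        T.RX.label_Arr[OF w] T.comp(2)[of k]
      by (simp add: c map_arrow_def push t u)
  next
    show "is_functor (res_comp u k \<circ>\<^sub>F res_comp t k)"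
      by (intro is_functor_comp_functor T.is_functor_res_comp U.is_functor_res_comp) (simp add: tu)
  next
    fix a assume "a \<in> Obj (Src (res_comp u k \<circ>\<^sub>F res_comp t k))"
    then have "a \<in> nodes (NSrc t) k" by simp
    then show "FOb (res_comp ?c k) a = FOb (res_comp u k \<circ>\<^sub>F res_comp t k) a"
      using C.res_comp_simps(3)[of a k] T.push_nodes[of a k] U.res_comp_simps(3)[of "push t a" k]
      by (simp add: c push t u)
  qed (use C.is_functor_res_comp c t u in simp_all)
  moreover have "simplicial_map (res_map u)" "simplicial_map (res_map t)" "NTgt (res_map t) = NSrc (res_map u)"
    using U.simplicial_map_res_map T.simplicial_map_res_map tu by (simp_all add: res_map_def)
  ultimately show "res_map ?c = Cmp SimpCat (res_map u) (res_map t)"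
    using Cmp_SimpCat[of "res_map u" "res_map t"] t u c
    by (simp add: res_map_def cong: restrict_cong)
qed (rule category_SimpCat)+

end

text \<open>Used to restrict the resolution to \<open>Ta2\<close>. Only the source is cut down:
  level 0 of a resolution need not be discrete, as distinct nodes with equal evaluation are
  isomorphic.\<close>

lemma is_functor_full_subcategory:
  assumes "is_functor F"
  shows "is_functor (mk_functor (full_subcategory (Src F) S) (Tgt F) (FOb F) (FAr F))"
proof -
  interpret is_functor F by fact
  note d = full_subcategory_def
  show ?thesis
  proof (rule is_functor_mk_functor)
    fix g f x y z
    assume "g \<in> hom (full_subcategory (Src F) S) y z" "f \<in> hom (full_subcategory (Src F) S) x y"
    then show "FAr F (Cmp (full_subcategory (Src F) S) g f) = Cmp (Tgt F) (FAr F g) (FAr F f)"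
      by (auto simp: d composable_def intro!: pres_cmp)
  qed (auto simp: source.category_full_subcategory[unfolded d] target.category_axioms d ob pres_id ar)
qed

theorem theorem3p7:
  assumes "infinite (UNIV :: 'u set)"
  shows "\<exists>R :: ('u simp_cat, 'u simp_map, 'u simp_cat, 'u simp_map) ftor.
    is_functor R \<and> Src R = Ta2 \<and> Tgt R = SimpCat \<and>
    (\<forall>X \<in> Obj Ta2.
      (\<forall>n \<ge> 2. is_isomorphism (segal_map (FOb R X) n)) \<and>
      (\<exists>r :: (nat, darr, 'u) pseudo.
        pseudo_nat_trans r \<and> PSrc r = FOb R X \<and> PTgt r = X \<and> levelwise_equivalence r \<and>
        (\<forall>n \<ge> 2. is_equivalence (base_change (FOb R X) (PFun r 0) n))))"
proof -
  \<comment> \<open>The coding is fixed before any \<open>X\<close> is considered, so that a single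
    functor serves all of \<open>Ta2\<close>.\<close>
  obtain node :: "darr \<Rightarrow> 'u \<Rightarrow> 'u" and shape point arrow tail head label
    where coding: "coding node shape point arrow tail head label"
    using ex_coding[OF assms] by blast
  interpret coding node shape point arrow tail head label by (rule coding)
  define R where "R = mk_functor Ta2 SimpCat (FOb (mk_functor SimpCat SimpCat res res_map))
    (FAr (mk_functor SimpCat SimpCat res res_map))"
  have "is_functor R"
    unfolding R_def Ta2_def using is_functor_full_subcategory[OF is_functor_res] by simp
  moreover have "(\<forall>n \<ge> 2. is_isomorphism (segal_map (FOb R X) n)) \<and>
      (\<exists>r :: (nat, darr, 'u) pseudo.
        pseudo_nat_trans r \<and> PSrc r = FOb R X \<and> PTgt r = X \<and> levelwise_equivalence r \<and>
        (\<forall>n \<ge> 2. is_equivalence (base_change (FOb R X) (PFun r 0) n)))" if X: "X \<in> Obj Ta2" for X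
  proof -
    have X': "X \<in> Obj SimpCat" and segal: "\<And>n. n \<ge> 2 \<Longrightarrow> is_equivalence (segal_map X n)"
      using X by (auto simp: Ta2_def full_subcategory_def)
    interpret resolution node shape point arrow tail head label X
      using X' by (simp add: resolution_def coding Obj_SimpCat)
    have RX: "FOb R X = res X" using X X' by (simp add: R_def)
    show ?thesis unfolding RX
      using is_isomorphism_segal_res segal is_equivalence_base_change
        pseudo_nat_trans_resolution_map levelwise_equivalence_resolution_map
      by (intro conjI exI[of _ resolution_map]) (auto simp: resolution_map_def)
  qed
  ultimately show ?thesis by (intro exI[of _ R]) (simp add: R_def)
qed

end
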